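(* Let $c\in\{0,1,2\}$ and let $\pi=(d_1,d_2,\ldots,d_n)$, $d_1\ge\cdots\ge d_n$, be the degree sequence of some $c$-cyclic graph, with $d_n=1$. Let $\Gamma(\pi)$ be the class of connected graphs with degree sequence $\pi$. Then: (i) if $c=0$, $T_M(\pi)$ is a precisely extremal graph of $\Gamma(\pi)$; (ii) if $c=1$, $U_M(\pi)$ is a precisely extremal graph of $\Gamma(\pi)$; (iii) if $c=2$, $B_M(\pi)$ is a precisely extremal graph of $\Gamma(\pi)$.
   Context: All graphs are simple, undirected, connected; $d(u)$ is the degree and $N(u)$ the neighbor set of $u$. A connected graph with $n$ vertices and $n+c-1$ edges is $c$-cyclic. For real $\alpha\ne0$, $SO_\alpha(G)=\sum_{uv\in E(G)}[d(u)^2+d(v)^2]^\alpha$. A graph $G\in\Gamma(\pi)$ is a precisely extremal graph of $\Gamma(\pi)$ if $G$ has minimum $SO_\alpha$ among all graphs of $\Gamma(\pi)$ for every $0<\alpha<1$, and has maximum $SO_\alpha$ among all graphs of $\Gamma(\pi)$ for every $\alpha>1$ and every $\alpha<0$. A connected graph $G$ is a $BFS$-graph if there is an ordering $v_1\prec\cdots\prec v_n$ of $V(G)$ with (a) $d(v_1)\ge\cdots\ge d(v_n)$ and $h(v_1)\le\cdots\le h(v_n)$, where $h(v_i)$ is the distance from $v_i$ to $v_1$; (b) whenever $v\in N(u)\setminus N(w)$, $z\in N(w)\setminus N(u)$, $h(v)=h(u)+1$, $h(z)=h(w)+1$ and $u\prec w$, then $v\prec z$. $T_M(\pi)$ denotes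 the unique $BFS$-tree with tree degree sequence $\pi$ (greedy tree). $U_M(\pi)$ (for a unicyclic degree sequence with $d_n=1$) is the unicyclic graph built by breadth-first search: its unique cycle is the triangle on $v_1,v_2,v_3$; $N(v_1)=\{v_2,\ldots,v_{d_1+1}\}$; $N(v_2)=\{v_1,v_3,v_{d_1+2},\ldots,v_{d_1+d_2-1}\}$; $N(v_3)=\{v_1,v_2,v_{d_1+d_2},\ldots,v_{d_1+d_2+d_3-3}\}$; then $d_4-1$ new vertices are appended to $v_4$, namely $N(v_4)=\{v_1,v_{d_1+d_2+d_3-2},\ldots,v_{d_1+d_2+d_3+d_4-4}\}$, and so on in order, with $d(v_i)=d_i$ (equivalently, it is the $BFS$-tree for the corresponding tree sequence with the edge $v_2v_3$ added). The reduced graph $\mathcal R(G)$ is obtained from $G$ by recursively deleting pendent vertices until none remain. Let $B_1$ be the graph on $\{v_1,v_2,v_3,v_4\}$ with edges $v_1v_2,v_1v_3,v_1v_4,v_2v_3,v_2v_4$, and let $B_2$ be the graph on $\{v_1,\ldots,v_5\}$ consisting of two triangles $v_1v_2v_3$ and $v_1v_4v_5$ sharing $v_1$. For a bicyclic degree sequence with $d_n=1$: if $d_1\ge d_2\ge 3$, $B_M(\pi)$ is the $BFS$-graph in $\Gamma(\pi)$ with $\mathcal R(B_M(\pi))=B_1$ (on the first four vertices of the ordering) and the remaining vertices in $BFS$-ordering; if $d_1\ge5>d_2=2$, $B_M(\pi)$ is the bicyclic graph on $n$ vertices obtained from $B_2$ by attaching $d_1-4$ paths of almost equal lengths (lengths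 pairwise differing by at most $1$) at $v_1$. *)

theory Defs
  imports Complex_Main "HOL-Library.Multiset"
begin

type_synonym 'a ugraph = "'a set \<times> 'a set set"

abbreviation verts :: "'a ugraph \<Rightarrow> 'a set" where
  "verts G \<equiv> fst G"

abbreviation edges :: "'a ugraph \<Rightarrow> 'a set set" where
  "edges G \<equiv> snd G"

definition simple_graph :: "'a ugraph \<Rightarrow> bool" where
  "simple_graph G \<longleftrightarrow> finite (verts G) \<and> verts G \<noteq> {} \<and>
     (\<forall>e\<in>edges G. e \<subseteq> verts G \<and> card e = 2)"

definition nbhd :: "'a ugraph \<Rightarrow> 'a \<Rightarrow> 'a set" where
  "nbhd G u = {v. {u, v} \<in> edges G}"

definition degree :: "'a ugraph \<Rightarrow> 'a \<Rightarrow> nat" where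
  "degree G u = card (nbhd G u)"

definition adj :: "'a ugraph \<Rightarrow> ('a \<times> 'a) set" where
  "adj G = {(u, v). {u, v} \<in> edges G}"

definition connected_graph :: "'a ugraph \<Rightarrow> bool" where
  "connected_graph G \<longleftrightarrow> simple_graph G \<and> (\<forall>u\<in>verts G. \<forall>v\<in>verts G. (u, v) \<in> (adj G)\<^sup>*)"

definition distance :: "'a ugraph \<Rightarrow> 'a \<Rightarrow> 'a \<Rightarrow> nat" where
  "distance G u v = (LEAST k. (u, v) \<in> adj G ^^ k)"

definition c_cyclic :: "nat \<Rightarrow> 'a ugraph \<Rightarrow> bool" where
  "c_cyclic c G \<longleftrightarrow> connected_graph G \<and> card (edges G) + 1 = card (verts G) + c"

text \<open>The class \<open>\<Gamma>(\<pi>)\<close>. Only the multiset of entries of \<open>\<pi>\<close> is compared here; that \<open>\<pi>\<close> is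
  non-increasing is assumed separately.\<close>

definition graph_class :: "nat list \<Rightarrow> 'a ugraph set" where
  "graph_class \<pi> =
     {G. connected_graph G \<and> image_mset (degree G) (mset_set (verts G)) = mset \<pi>}"

text \<open>For an edge \<open>e = {u, v}\<close> the inner sum is \<open>d(u)\<^sup>2 + d(v)\<^sup>2\<close>.\<close>

definition SO :: "real \<Rightarrow> 'a ugraph \<Rightarrow> real" where
  "SO \<alpha> G = (\<Sum>e\<in>edges G. (\<Sum>u\<in>e. (real (degree G u))\<^sup>2) powr \<alpha>)"

definition precisely_extremal :: "nat list \<Rightarrow> 'a ugraph \<Rightarrow> bool" where
  "precisely_extremal \<pi> G \<longleftrightarrow> G \<in> graph_class \<pi> \<and>
     (\<forall>\<alpha>. 0 < \<alpha> \<and> \<alpha> < 1 \<longrightarrow> (\<forall>H\<in>(graph_class \<pi> :: 'a ugraph set). SO \<alpha> G \<le> SO \<alpha> H)) \<and>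
     (\<forall>\<alpha>. \<alpha> > 1 \<or> \<alpha> < 0 \<longrightarrow> (\<forall>H\<in>(graph_class \<pi> :: 'a ugraph set). SO \<alpha> H \<le> SO \<alpha> G))"

text \<open>An ordering \<open>v\<^sub>1 \<prec> \<dots> \<prec> v\<^sub>n\<close> of the vertices is a bijection \<open>v\<close> from \<open>{1..n}\<close>, so that
  \<open>\<prec>\<close> becomes \<open><\<close> on indices. In the last clause the vertices called \<open>u, v, w, z\<close> in the
  usual definition are \<open>v i, v j, v k, v l\<close>.\<close>

definition bfs_ordering :: "'a ugraph \<Rightarrow> (nat \<Rightarrow> 'a) \<Rightarrow> bool" where
  "bfs_ordering G v \<longleftrightarrow>
     (let n = card (verts G); h = (\<lambda>x. distance G x (v 1)) in
        bij_betw v {1..n} (verts G) \<and>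
        (\<forall>i\<in>{1..n}. \<forall>j\<in>{1..n}. i \<le> j \<longrightarrow>
           degree G (v j) \<le> degree G (v i) \<and> h (v i) \<le> h (v j)) \<and>
        (\<forall>i\<in>{1..n}. \<forall>j\<in>{1..n}. \<forall>k\<in>{1..n}. \<forall>l\<in>{1..n}.
           v j \<in> nbhd G (v i) - nbhd G (v k) \<and> v l \<in> nbhd G (v k) - nbhd G (v i) \<and>
           h (v j) = h (v i) + 1 \<and> h (v l) = h (v k) + 1 \<and> i < k \<longrightarrow> j < l))"

definition bfs_graph :: "'a ugraph \<Rightarrow> bool" where
  "bfs_graph G \<longleftrightarrow> connected_graph G \<and> (\<exists>v. bfs_ordering G v)"

text \<open>The extremal graphs are determined only up to isomorphism, so they are given as predicates:
  \<open>is_T_M \<pi> G\<close> says that \<open>G\<close> is (a copy of) \<open>T\<^sub>M(\<pi>)\<close>, and likewise for \<open>U\<^sub>M\<close> and \<open>B\<^sub>M\<close>.\<close>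

definition is_T_M :: "nat list \<Rightarrow> 'a ugraph \<Rightarrow> bool" where
  "is_T_M \<pi> G \<longleftrightarrow> G \<in> graph_class \<pi> \<and> c_cyclic 0 G \<and> bfs_graph G"

definition dg :: "nat list \<Rightarrow> nat \<Rightarrow> nat" where
  "dg \<pi> i = \<pi> ! (i - 1)"

text \<open>For \<open>i \<ge> 4\<close>, the new vertices appended to \<open>v\<^sub>i\<close> are those with indices from
  \<open>(d\<^sub>1 + \<dots> + d\<^bsub>i-1\<^esub>) - (i - 2)\<close> to \<open>(d\<^sub>1 + \<dots> + d\<^sub>i) - i\<close>; the only other neighbour of \<open>v\<^sub>i\<close> is the
  earlier vertex \<open>v\<^sub>p\<close> to which \<open>v\<^sub>i\<close> itself was appended, and \<open>p\<close> is forced by the symmetry of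
  adjacency.\<close>

definition is_U_M :: "nat list \<Rightarrow> 'a ugraph \<Rightarrow> bool" where
  "is_U_M \<pi> G \<longleftrightarrow> c_cyclic 1 G \<and>
     (\<exists>v. bij_betw v {1..length \<pi>} (verts G) \<and>
        (\<forall>i\<in>{1..length \<pi>}. degree G (v i) = dg \<pi> i) \<and>
        nbhd G (v 1) = v ` {2..dg \<pi> 1 + 1} \<and>
        nbhd G (v 2) = v ` ({1, 3} \<union> {dg \<pi> 1 + 2..dg \<pi> 1 + dg \<pi> 2 - 1}) \<and>
        nbhd G (v 3) = v ` ({1, 2} \<union> {dg \<pi> 1 + dg \<pi> 2..dg \<pi> 1 + dg \<pi> 2 + dg \<pi> 3 - 3}) \<and>
        (\<forall>i\<in>{4..length \<pi>}. \<exists>p\<in>{1..<i}.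
           nbhd G (v i) =
             v ` ({p} \<union> {(\<Sum>k=1..i-1. dg \<pi> k) - (i - 2)..(\<Sum>k=1..i. dg \<pi> k) - i})))"

definition delete_vertex :: "'a ugraph \<Rightarrow> 'a \<Rightarrow> 'a ugraph" where
  "delete_vertex G u = (verts G - {u}, {e \<in> edges G. u \<notin> e})"

definition delete_pendent :: "'a ugraph \<Rightarrow> 'a ugraph \<Rightarrow> bool" where
  "delete_pendent G H \<longleftrightarrow> (\<exists>u\<in>verts G. degree G u = 1 \<and> H = delete_vertex G u)"

definition is_reduced_graph :: "'a ugraph \<Rightarrow> 'a ugraph \<Rightarrow> bool" where
  "is_reduced_graph G R \<longleftrightarrow> delete_pendent\<^sup>*\<^sup>* G R \<and> (\<forall>u\<in>verts R. degree R u \<noteq> 1)"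

definition B1 :: "'a \<Rightarrow> 'a \<Rightarrow> 'a \<Rightarrow> 'a \<Rightarrow> 'a ugraph" where
  "B1 a b c d = ({a, b, c, d}, {{a, b}, {a, c}, {a, d}, {b, c}, {b, d}})"

definition B2 :: "'a \<Rightarrow> 'a \<Rightarrow> 'a \<Rightarrow> 'a \<Rightarrow> 'a \<Rightarrow> 'a ugraph" where
  "B2 a b c d e = ({a, b, c, d, e}, {{a, b}, {a, c}, {b, c}, {a, d}, {a, e}, {d, e}})"

definition path_edges :: "'a list \<Rightarrow> 'a set set" where
  "path_edges xs = {{xs ! i, xs ! Suc i} | i. Suc i < length xs}"

text \<open>Attaching to \<open>a\<close> the paths \<open>a, x\<^sub>1, \<dots>, x\<^sub>l\<close>, one for each list \<open>[x\<^sub>1, \<dots>, x\<^sub>l]\<close> in \<open>ps\<close>; the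
  length of such a path is the length \<open>l\<close> of the list.\<close>

definition attach_paths :: "'a ugraph \<Rightarrow> 'a \<Rightarrow> 'a list list \<Rightarrow> 'a ugraph" where
  "attach_paths G a ps =
     (verts G \<union> set (concat ps), edges G \<union> (\<Union>p\<in>set ps. path_edges (a # p)))"

definition is_B_M :: "nat list \<Rightarrow> 'a ugraph \<Rightarrow> bool" where
  "is_B_M \<pi> G \<longleftrightarrow>
     (dg \<pi> 1 \<ge> dg \<pi> 2 \<and> dg \<pi> 2 \<ge> 3 \<and> G \<in> graph_class \<pi> \<and>
        (\<exists>v. bfs_ordering G v \<and> is_reduced_graph G (B1 (v 1) (v 2) (v 3) (v 4)))) \<or>
     (dg \<pi> 1 \<ge> 5 \<and> dg \<pi> 2 = 2 \<and> card (verts G) = length \<pi> \<and>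
        (\<exists>v1 v2 v3 v4 v5 ps.
           distinct ([v1, v2, v3, v4, v5] @ concat ps) \<and>
           length ps = dg \<pi> 1 - 4 \<and> (\<forall>p\<in>set ps. p \<noteq> []) \<and>
           (\<forall>p\<in>set ps. \<forall>q\<in>set ps. length p \<le> length q + 1) \<and>
           G = attach_paths (B2 v1 v2 v3 v4 v5) v1 ps))"

end

theory Submission
  imports Defs
begin

text \<open>
  The weight \<open>f(x, y) = (x\<^sup>2 + y\<^sup>2)\<^sup>\<alpha>\<close> is supermodular for \<open>\<alpha> > 1\<close> and \<open>\<alpha> < 0\<close> and submodular for
  \<open>0 < \<alpha> < 1\<close>. Up to a term that only depends on the degree sequence, a supermodular weight is a
  nonnegative combination of threshold weights, so it suffices that the extremal graph maximises,
  simultaneously for all \<open>a \<ge> b\<close>, the number of arcs from \<open>A = {u. d(u) \<ge> a}\<close> to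
  \<open>B = {u. d(u) \<ge> b}\<close>. This number is \<open>e(A) + e\<^sub>A(B)\<close>, where \<open>e\<^sub>A(B)\<close> counts the edges inside \<open>B\<close>
  that meet \<open>A\<close>. It is at most the degree sum over \<open>A\<close>, and, since a set of \<open>p\<close> vertices of a
  \<open>c\<close>-cyclic graph spans at most \<open>p - 1 + c\<close> edges, it is bounded in terms of \<open>|A|\<close> and \<open>|B|\<close>.
  If the vertices are numbered by breadth-first search with nonincreasing degrees, then \<open>A\<close> and \<open>B\<close>
  are initial segments, and one of the two bounds is attained: either all parents of vertices in
  \<open>B\<close> lie in \<open>A\<close>, or all neighbours of \<open>A\<close> lie in \<open>B\<close>. In the bicyclic case with \<open>d\<^sub>2 = 2\<close> only the
  thresholds \<open>1\<close>, \<open>2\<close> and \<open>d\<^sub>1\<close> matter, and the same bounds are attained.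
\<close>

section \<open>Arcs between sets of vertices\<close>

text \<open>One graph has to be optimal for all pairs of thresholds at once, although different
  thresholds could ask for different graphs. This works because all \<open>c\<close> extra edges
  share the second vertex and end in the \<open>c\<close> vertices after it: every initial segment
  then spans as many edges as any set of its size can, first a triangle and, for
  \<open>c = 2\<close>, four vertices with five edges. Here \<open>c \<le> 2\<close> matters: with
  three extra edges the densest four vertices form a complete graph, which this arrangement does not
  contain.

  A one-element \<open>A\<close> is exceptional. The extra edges miss the root, so the edge bound
  for \<open>B\<close> cannot be attained and is replaced by \<open>card B - 1\<close>, the number
  of possible neighbours inside \<open>B\<close>.

  Existence of the graphs is also part of the claim. The sequence must leave room for the extra
  edges, that is, its entry number \<open>c + 2\<close> must be at least 2 when \<open>c\<close> is
  positive. This comes from the same edge bound, applied to the vertices of degree at least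
  2.\<close>

definition arcs_between :: "'a ugraph \<Rightarrow> 'a set \<Rightarrow> 'a set \<Rightarrow> ('a \<times> 'a) set" where
  "arcs_between G A B = adj G \<inter> A \<times> B"

definition level :: "'a ugraph \<Rightarrow> nat \<Rightarrow> 'a set" where
  "level G a = {u \<in> verts G. a \<le> degree G u}"

definition edges_in :: "'a ugraph \<Rightarrow> 'a set \<Rightarrow> 'a set set" where
  "edges_in G S = {e \<in> edges G. e \<subseteq> S}"

section \<open>Adjacency and double counting of arcs\<close>

lemma simple_graph_finite_edges:
  assumes "simple_graph G" shows "finite (edges G)"
proof -
  have "edges G \<subseteq> Pow (verts G)" using assms by (auto simp: simple_graph_def)
  then show ?thesis using assms by (auto simp: simple_graph_def intro: finite_subset)
qed

lemma adj_iff_nbhd: "(u, v) \<in> adj G \<longleftrightarrow> v \<in> nbhd G u"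
  by (simp add: adj_def nbhd_def)

lemma adj_in_verts:
  assumes "simple_graph G" "(u, v) \<in> adj G"
  shows "u \<in> verts G" "v \<in> verts G" "u \<noteq> v"
proof -
  have "{u, v} \<subseteq> verts G" "card {u, v} = 2"
    using assms by (auto simp: simple_graph_def adj_def)
  then show "u \<in> verts G" "v \<in> verts G" "u \<noteq> v" by (auto simp: card_insert_if split: if_splits)
qed

lemma finite_adj:
  assumes "simple_graph G" shows "finite (adj G)"
proof (rule finite_subset)
  show "adj G \<subseteq> verts G \<times> verts G" using adj_in_verts[OF assms] by auto
  show "finite (verts G \<times> verts G)" using assms by (simp add: simple_graph_def)
qed

lemma nbhd_subset:
  assumes "simple_graph G" shows "nbhd G u \<subseteq> verts G - {u}"
proof
  fix v assume "v \<in> nbhd G u"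
  then have "(u, v) \<in> adj G" by (simp add: adj_iff_nbhd)
  then show "v \<in> verts G - {u}" using adj_in_verts[OF assms, of u v] by simp
qed

lemma finite_nbhd:
  assumes "simple_graph G" shows "finite (nbhd G u)"
  by (rule finite_subset[OF nbhd_subset[OF assms]]) (use assms in \<open>simp add: simple_graph_def\<close>)

lemma degree_pos_if_adj:
  assumes "simple_graph G" "(u, v) \<in> adj G"
  shows "1 \<le> degree G u" "1 \<le> degree G v"
proof -
  have "v \<in> nbhd G u" "u \<in> nbhd G v"
    using assms(2) by (auto simp: adj_def nbhd_def insert_commute)
  then show "1 \<le> degree G u" "1 \<le> degree G v"
    unfolding degree_def using finite_nbhd[OF assms(1)]
    by (auto simp: Suc_le_eq card_gt_0_iff)
qed

lemma adj_eq_Sigma: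
  assumes "simple_graph G" shows "adj G = Sigma (verts G) (nbhd G)"
proof -
  have "(u, v) \<in> adj G \<longleftrightarrow> (u, v) \<in> Sigma (verts G) (nbhd G)" for u v
    using adj_in_verts(1)[OF assms, of u v] unfolding adj_iff_nbhd by blast
  then show ?thesis by auto
qed

lemma sum_adj_fst:
  fixes g :: "'a \<Rightarrow> real"
  assumes "simple_graph G"
  shows "(\<Sum>(u, v)\<in>adj G. g u) = (\<Sum>u\<in>verts G. real (degree G u) * g u)"
proof -
  have "(\<Sum>(u, v)\<in>adj G. g u) = (\<Sum>u\<in>verts G. \<Sum>v\<in>nbhd G u. g u)"
    unfolding adj_eq_Sigma[OF assms]
    by (rule sum.Sigma[symmetric]) (use assms finite_nbhd[OF assms] in \<open>auto simp: simple_graph_def\<close>)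
  then show ?thesis by (simp add: degree_def)
qed

lemma sum_adj_swap:
  "(\<Sum>(u, v)\<in>adj G. g u v) = (\<Sum>(u, v)\<in>adj G. g v u)"
  by (rule sum.reindex_bij_witness[of _ prod.swap prod.swap]) (auto simp: adj_def insert_commute)

lemma sum_adj_edges:
  fixes g :: "'a \<times> 'a \<Rightarrow> 'b::comm_monoid_add"
  assumes "simple_graph G"
  shows "(\<Sum>x\<in>adj G. g x) = (\<Sum>e\<in>edges G. \<Sum>x\<in>{(u, v). {u, v} = e}. g x)"
proof -
  have "(\<Sum>e\<in>edges G. \<Sum>x\<in>{x \<in> adj G. (\<lambda>(u, v). {u, v}) x = e}. g x) = (\<Sum>x\<in>adj G. g x)"
    by (rule sum.group)
      (use finite_adj[OF assms] simple_graph_finite_edges[OF assms] in \<open>auto simp: adj_def\<close>)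
  moreover have "{x \<in> adj G. (\<lambda>(u, v). {u, v}) x = e} = {(u, v). {u, v} = e}" if "e \<in> edges G" for e
    using that by (auto simp: adj_def)
  ultimately show ?thesis by simp
qed

lemma edge_obtain:
  assumes "simple_graph G" "e \<in> edges G"
  obtains x y where "e = {x, y}" "x \<noteq> y" "x \<in> verts G" "y \<in> verts G"
proof -
  have "card e = 2" "e \<subseteq> verts G" using assms by (auto simp: simple_graph_def)
  then show thesis using that by (auto simp: card_2_iff)
qed

lemma ordered_pairs_of_edge:
  "x \<noteq> y \<Longrightarrow> {(u, v). {u, v} = {x, y}} = {(x, y), (y, x)}"
  by (auto simp: doubleton_eq_iff)

lemma sum_adj_of_edge:
  fixes F :: "'a set \<Rightarrow> real"
  assumes "simple_graph G"
  shows "(\<Sum>(u, v)\<in>adj G. F {u, v}) = 2 * (\<Sum>e\<in>edges G. F e)"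
proof -
  have "(\<Sum>x\<in>{(u, v). {u, v} = e}. (\<lambda>(u, v). F {u, v}) x) = 2 * F e" if "e \<in> edges G" for e
  proof -
    obtain x y where e: "e = {x, y}" "x \<noteq> y" using edge_obtain[OF assms \<open>e \<in> edges G\<close>] by metis
    show ?thesis unfolding e(1) ordered_pairs_of_edge[OF e(2)] using e(2) by (simp add: insert_commute)
  qed
  then show ?thesis by (simp add: sum_adj_edges[OF assms] sum_distrib_left)
qed

lemma card_adj:
  assumes "simple_graph G" shows "card (adj G) = 2 * card (edges G)"
proof -
  have "real (card (adj G)) = real (2 * card (edges G))"
    using sum_adj_of_edge[OF assms, of "\<lambda>_. 1"] by (simp add: case_prod_unfold)
  then show ?thesis using of_nat_eq_iff by blast
qed

lemma handshake:
  assumes "simple_graph G" shows "(\<Sum>u\<in>verts G. degree G u) = 2 * card (edges G)"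
proof -
  have "card (adj G) = (\<Sum>u\<in>verts G. card (nbhd G u))"
    unfolding adj_eq_Sigma[OF assms]
    by (rule card_SigmaI) (use assms finite_nbhd[OF assms] in \<open>auto simp: simple_graph_def\<close>)
  then show ?thesis using card_adj[OF assms] by (simp add: degree_def)
qed

text \<open>An edge inside \<open>A\<close> carries two of the arcs and is counted in both summands,
  because \<open>A \<subseteq> B\<close>. An edge from \<open>A\<close> to \<open>B - A\<close>
  carries one and is counted only in the second.\<close>

lemma card_arcs_between:
  assumes "simple_graph G" "A \<subseteq> B"
  shows "card (arcs_between G A B)
    = card (edges_in G A) + card {e \<in> edges_in G B. e \<inter> A \<noteq> {}}"
proof -
  note fin = finite_adj[OF assms(1)] and finE = simple_graph_finite_edges[OF assms(1)]
  have "card (arcs_between G A B) = (\<Sum>x\<in>adj G. if x \<in> A \<times> B then 1 else 0)"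
    unfolding arcs_between_def using fin by (simp add: sum.If_cases)
  also have "\<dots> = (\<Sum>e\<in>edges G. \<Sum>x\<in>{(u, v). {u, v} = e}. if x \<in> A \<times> B then 1 else 0)"
    by (rule sum_adj_edges[OF assms(1)])
  also have "\<dots> = (\<Sum>e\<in>edges G. (if e \<subseteq> A then 1 else 0) + (if e \<subseteq> B \<and> e \<inter> A \<noteq> {} then 1 else 0))"
  proof (rule sum.cong[OF refl])
    fix e assume "e \<in> edges G"
    then obtain x y where e: "e = {x, y}" "x \<noteq> y" using edge_obtain[OF assms(1)] by metis
    show "(\<Sum>x\<in>{(u, v). {u, v} = e}. if x \<in> A \<times> B then 1 else 0)
        = (if e \<subseteq> A then 1 else (0::nat)) + (if e \<subseteq> B \<and> e \<inter> A \<noteq> {} then 1 else 0)"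
      unfolding e(1) ordered_pairs_of_edge[OF e(2)] using e(2) assms(2) by auto
  qed
  also have "\<dots> = card (edges_in G A) + card {e \<in> edges_in G B. e \<inter> A \<noteq> {}}"
    unfolding edges_in_def using finE by (simp add: sum.distrib sum.If_cases Int_def conj_assoc)
  finally show ?thesis .
qed

lemma card_arcs_between_commute: "card (arcs_between G A B) = card (arcs_between G B A)"
  by (rule bij_betw_same_card[of prod.swap], rule bij_betw_byWitness[of _ prod.swap])
    (auto simp: arcs_between_def adj_def insert_commute)

section \<open>Upper bounds for edges and arcs in a c-cyclic graph\<close>

text \<open>Connectedness supplies an edge leaving \<open>S\<close>; adding its outer end to
  \<open>S\<close> gains at least one edge per vertex. No connectedness of \<open>S\<close> itself
  is involved, so the bound applies to the degree levels of an arbitrary competitor.\<close>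

lemma card_edges_in_growth:
  assumes "connected_graph G" "S \<subseteq> verts G" "S \<noteq> {}"
  shows "card (edges_in G S) + card (verts G - S) \<le> card (edges G)"
  using assms(2,3)
proof (induction "card (verts G - S)" arbitrary: S)
  case 0
  have "simple_graph G" using assms(1) by (simp add: connected_graph_def)
  then have "finite (edges G)" by (rule simple_graph_finite_edges)
  then have "card (edges_in G S) \<le> card (edges G)" by (auto simp: edges_in_def intro: card_mono)
  then show ?case using 0 by simp
next
  case (Suc k)
  have sg: "simple_graph G" using assms(1) by (simp add: connected_graph_def)
  then have fin: "finite (verts G)" "finite (edges G)"
    by (auto simp: simple_graph_def simple_graph_finite_edges)
  obtain s where s: "s \<in> S" using Suc.prems by blast
  have "verts G - S \<noteq> {}" using Suc.hyps(2) by (metis card.empty nat.distinct(1))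
  then obtain t where t: "t \<in> verts G - S" by blast
  have "(s, t) \<in> (adj G)\<^sup>*" using assms(1) s t Suc.prems by (auto simp: connected_graph_def)
  \<comment> \<open>A walk from \<open>s\<close> either stays in \<open>S\<close> or crosses its
    boundary; the disjunction is what survives induction along the walk.\<close>
  have "t \<in> S \<or> (\<exists>x y. x \<in> S \<and> y \<notin> S \<and> (x, y) \<in> adj G)"
    using \<open>(s, t) \<in> (adj G)\<^sup>*\<close> by (induction rule: rtrancl_induct) (use s in blast)+
  then obtain x y where xy: "x \<in> S" "y \<notin> S" "(x, y) \<in> adj G" using t by blast
  have y: "y \<in> verts G" using adj_in_verts[OF sg xy(3)] by simp
  have "verts G - insert y S = (verts G - S) - {y}" by blast
  then have c: "card (verts G - insert y S) = k" using Suc.hyps(2) y xy fin by simp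
  have "card (edges_in G (insert y S)) + card (verts G - insert y S) \<le> card (edges G)"
    by (rule Suc.hyps(1)) (use c y Suc.prems in auto)
  moreover have "card (insert {x, y} (edges_in G S)) \<le> card (edges_in G (insert y S))"
    by (rule card_mono) (use fin xy in \<open>auto simp: edges_in_def adj_def\<close>)
  moreover have "{x, y} \<notin> edges_in G S" using xy by (auto simp: edges_in_def)
  moreover have "finite (edges_in G S)" using fin by (simp add: edges_in_def)
  ultimately show ?case using c Suc.hyps(2) by simp
qed

text \<open>For \<open>c \<le> 2\<close> and \<open>p \<ge> 1\<close> this is the minimum of \<open>p - 1 + c\<close> and \<open>p choose 2\<close>.\<close>

definition edge_bound :: "nat \<Rightarrow> nat \<Rightarrow> nat" where
  "edge_bound c p = p - 1 + min c (p - 2)"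

text \<open>From four vertices on, the linear bound suffices because \<open>c \<le> 2\<close>;
  smaller sets may need the binomial bound. For \<open>c = 3\<close> the complete graph on four
  vertices would exceed \<open>edge_bound\<close>.\<close>

lemma card_edges_in_le:
  assumes "c_cyclic c G" "c \<le> 2" "S \<subseteq> verts G" "S \<noteq> {}"
  shows "card (edges_in G S) \<le> edge_bound c (card S)"
proof -
  have con: "connected_graph G" and m: "card (edges G) + 1 = card (verts G) + c"
    using assms(1) by (auto simp: c_cyclic_def)
  then have sg: "simple_graph G" by (simp add: connected_graph_def)
  then have fin: "finite (verts G)" by (simp add: simple_graph_def)
  then have finS: "finite S" using assms(3) finite_subset by blast
  have "card (edges_in G S) + card (verts G - S) \<le> card (edges G)"
    by (rule card_edges_in_growth[OF con assms(3,4)])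
  moreover have "card (verts G - S) = card (verts G) - card S" "card S \<le> card (verts G)"
    using assms(3) finS fin by (auto simp: card_Diff_subset card_mono)
  ultimately have 1: "card (edges_in G S) + 1 \<le> card S + c" using m by simp
  have "edges_in G S \<subseteq> {e. e \<subseteq> S \<and> card e = 2}"
    using sg by (auto simp: edges_in_def simple_graph_def)
  then have "card (edges_in G S) \<le> card {e. e \<subseteq> S \<and> card e = 2}"
    by (rule card_mono[rotated]) (simp add: finS)
  then have 2: "card (edges_in G S) \<le> card S choose 2" using n_subsets[OF finS] by metis
  have "card S > 0" using finS assms(4) by auto
  then consider "card S = 1" | "card S = 2" | "card S = 3" | "card S \<ge> 4" by linarith
  then show ?thesis
  proof cases
    case 3 with 1 2 assms(2) show ?thesis by (simp add: edge_bound_def choose_two)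
  qed (use 1 2 assms(2) in \<open>auto simp: edge_bound_def choose_two\<close>)
qed

lemma card_arcs_between_le_edge_bound:
  assumes "c_cyclic c G" "c \<le> 2" "A \<subseteq> B" "B \<subseteq> verts G" "A \<noteq> {}"
  shows "card (arcs_between G A B) \<le> edge_bound c (card A) + edge_bound c (card B)"
proof -
  have sg: "simple_graph G" using assms(1) by (simp add: c_cyclic_def connected_graph_def)
  have "card {e \<in> edges_in G B. e \<inter> A \<noteq> {}} \<le> card (edges_in G B)"
    by (rule card_mono) (use simple_graph_finite_edges[OF sg] in \<open>auto simp: edges_in_def\<close>)
  moreover have "card (edges_in G A) \<le> edge_bound c (card A)" "card (edges_in G B) \<le> edge_bound c (card B)"
    using card_edges_in_le[OF assms(1,2)] assms(3-5) by auto
  ultimately show ?thesis by (simp add: card_arcs_between[OF sg assms(3)])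
qed

lemma card_arcs_from:
  assumes "simple_graph G" "A \<subseteq> verts G"
  shows "card (arcs_between G A B) = (\<Sum>u\<in>A. card (nbhd G u \<inter> B))"
proof -
  have "arcs_between G A B = Sigma A (\<lambda>u. nbhd G u \<inter> B)"
    by (auto simp: arcs_between_def adj_iff_nbhd)
  moreover have "finite A" using assms finite_subset by (auto simp: simple_graph_def)
  ultimately show ?thesis using finite_nbhd[OF assms(1)] by simp
qed

lemma card_arcs_between_le_degree_sum:
  assumes "simple_graph G" "A \<subseteq> verts G"
  shows "card (arcs_between G A B) \<le> (\<Sum>u\<in>A. degree G u)"
  unfolding card_arcs_from[OF assms] degree_def
  by (rule sum_mono, rule card_mono) (use finite_nbhd[OF assms(1)] in auto)

text \<open>Replaces the sum of edge bounds when the higher level is a single vertex: that sum also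
  counts cycle-closing edges of \<open>B\<close> that may miss \<open>u\<close>.\<close>

lemma card_arcs_from_singleton_le:
  assumes "simple_graph G" "u \<in> B" "B \<subseteq> verts G"
  shows "card (arcs_between G {u} B) \<le> card B - 1"
proof -
  have fin: "finite B" using assms finite_subset by (auto simp: simple_graph_def)
  have "card (nbhd G u \<inter> B) \<le> card (B - {u})"
    by (rule card_mono) (use fin nbhd_subset[OF assms(1), of u] in auto)
  then show ?thesis using card_arcs_from[OF assms(1), of "{u}" B] assms fin by auto
qed

section \<open>Quantities determined by the degree sequence\<close>

lemma graph_class_sum:
  assumes "G \<in> graph_class \<pi>"
  shows "(\<Sum>u\<in>verts G. g (degree G u)) = sum_mset (image_mset g (mset \<pi>))"
proof -
  have "image_mset (degree G) (mset_set (verts G)) = mset \<pi>"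
    using assms by (simp add: graph_class_def)
  then have "image_mset g (mset \<pi>) = image_mset (\<lambda>u. g (degree G u)) (mset_set (verts G))"
    by (metis (no_types, lifting) comp_apply image_mset.compositionality image_mset_cong)
  then show ?thesis by (simp add: sum_unfold_sum_mset)
qed

lemma graph_class_simple: "G \<in> graph_class \<pi> \<Longrightarrow> simple_graph G"
  by (simp add: graph_class_def connected_graph_def)

lemma graph_class_card_verts:
  assumes "G \<in> graph_class \<pi>" shows "card (verts G) = length \<pi>"
  using graph_class_sum[OF assms, of "\<lambda>_. 1::nat"] by simp

text \<open>Level sizes (\<open>g = 1\<close>) and level degree sums (\<open>g\<close> the identity)
  agree throughout the class, so bounds for a competitor can be evaluated in the candidate
  graph.\<close>

lemma graph_class_level_sum:
  fixes g :: "nat \<Rightarrow> nat" and G H :: "'a ugraph"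
  assumes "G \<in> graph_class \<pi>" "H \<in> graph_class \<pi>"
  shows "(\<Sum>u\<in>level H a. g (degree H u)) = (\<Sum>u\<in>level G a. g (degree G u))"
proof -
  have "(\<Sum>u\<in>level K a. g (degree K u)) = (\<Sum>u\<in>verts K. (\<lambda>d. if a \<le> d then g d else 0) (degree K u))"
    if "K \<in> graph_class \<pi>" for K :: "'a ugraph"
    using graph_class_simple[OF that]
    by (simp add: level_def simple_graph_def sum.If_cases Int_def)
  then show ?thesis using assms
      graph_class_sum[OF assms(1), of "\<lambda>d. if a \<le> d then g d else 0"]
      graph_class_sum[OF assms(2), of "\<lambda>d. if a \<le> d then g d else 0"]
    by simp
qed

lemma graph_class_card_level:
  fixes G H :: "'a ugraph"
  assumes "G \<in> graph_class \<pi>" "H \<in> graph_class \<pi>"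
  shows "card (level H a) = card (level G a)"
  using graph_class_level_sum[OF assms, of "\<lambda>_. 1"] by simp

lemma graph_class_card_edges:
  assumes "G \<in> graph_class \<pi>"
  shows "2 * card (edges G) = sum_list \<pi>"
  using handshake[OF graph_class_simple[OF assms]] graph_class_sum[OF assms, of "\<lambda>x. x"]
  by (simp add: sum_mset_sum_list)

lemma graph_class_c_cyclic:
  fixes G H :: "'a ugraph"
  assumes "G \<in> graph_class \<pi>" "H \<in> graph_class \<pi>" "c_cyclic c G"
  shows "c_cyclic c H"
  using assms graph_class_card_edges[OF assms(1)] graph_class_card_edges[OF assms(2)]
    graph_class_card_verts[OF assms(1)] graph_class_card_verts[OF assms(2)]
  by (simp add: c_cyclic_def graph_class_def)

section \<open>Supermodular weights\<close>

text \<open>The mixed second difference telescopes in each variable. The corrections depend on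
  \<open>x\<close> alone or on \<open>y\<close> alone, hence sum over arcs to a constant of the
  degree sequence.\<close>

lemma double_telescope:
  fixes f :: "nat \<Rightarrow> nat \<Rightarrow> real"
  assumes "1 \<le> x" "1 \<le> y"
  shows "(\<Sum>a=1..<x. \<Sum>b=1..<y. f (Suc a) (Suc b) - f a (Suc b) - f (Suc a) b + f a b)
    = f x y - f x 1 - f 1 y + f 1 1"
proof -
  have "(\<Sum>b=1..<y. f (Suc a) (Suc b) - f a (Suc b) - f (Suc a) b + f a b)
      = (f (Suc a) y - f (Suc a) 1) - (f a y - f a 1)" for a
  proof -
    have "(\<Sum>b=1..<y. f (Suc a) (Suc b) - f a (Suc b) - f (Suc a) b + f a b)
      = (\<Sum>b=1..<y. f (Suc a) (Suc b) - f (Suc a) b) - (\<Sum>b=1..<y. f a (Suc b) - f a b)"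
      by (simp add: sum_subtractf[symmetric] algebra_simps)
    then show ?thesis using assms by (simp add: sum_Suc_diff')
  qed
  then show ?thesis using sum_Suc_diff'[OF assms(1), of "\<lambda>a. f a y - f a 1"] by simp
qed

text \<open>Within the class, the weight sum is a constant plus a combination of the threshold arc
  counts with coefficients \<open>D a b \<ge> 0\<close>, so it is monotone in these counts.\<close>

lemma sum_adj_supermodular_mono:
  fixes f :: "nat \<Rightarrow> nat \<Rightarrow> real" and G H :: "'a ugraph"
  assumes G: "G \<in> graph_class \<pi>" and H: "H \<in> graph_class \<pi>"
    and super: "\<And>a b. 1 \<le> a \<Longrightarrow> 1 \<le> b \<Longrightarrow> 0 \<le> f (Suc a) (Suc b) - f a (Suc b) - f (Suc a) b + f a b"
    and arcs: "\<And>a b. card (arcs_between H (level H a) (level H b))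
                 \<le> card (arcs_between G (level G a) (level G b))"
  shows "(\<Sum>(u, v)\<in>adj H. f (degree H u) (degree H v)) \<le> (\<Sum>(u, v)\<in>adj G. f (degree G u) (degree G v))"
proof -
  \<comment> \<open>The coefficient of the threshold weight for degrees at least
    \<open>Suc a\<close> and at least \<open>Suc b\<close>. Thresholds start at 2, since both ends
    of an arc have degree at least 1.\<close>
  define D where "D a b = f (Suc a) (Suc b) - f a (Suc b) - f (Suc a) b + f a b" for a b
  \<comment> \<open>Exceeds every degree, so the range of thresholds is the same for all graphs of
    the class.\<close>
  define M where "M = Suc (Max (set \<pi>))"
  \<comment> \<open>The sum of \<open>f x 1 + f 1 y - f 1 1\<close> over all arcs: a vertex of
    degree \<open>d\<close> starts \<open>d\<close> arcs, and reversing arcs moves the second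
    variable to the start as well.\<close>
  define C where "C = sum_mset (image_mset (\<lambda>d. real d * (f d 1 + f 1 d - f 1 1)) (mset \<pi>))"
  have decomp: "(\<Sum>(u, v)\<in>adj K. f (degree K u) (degree K v))
      = C + (\<Sum>a=1..<M. \<Sum>b=1..<M. D a b * real (card (arcs_between K (level K (Suc a)) (level K (Suc b)))))"
    if K: "K \<in> graph_class \<pi>" for K :: "'a ugraph"
  proof -
    note sg = graph_class_simple[OF K]
    let ?d = "degree K"
    have le: "?d u < M" if "u \<in> verts K" for u
    proof -
      have "?d u \<in># image_mset ?d (mset_set (verts K))"
        using that sg by (simp add: simple_graph_def)
      then have "?d u \<in> set \<pi>" using K unfolding graph_class_def by (metis (mono_tags, lifting) mem_Collect_eq set_mset_mset)
      then show ?thesis by (simp add: M_def less_Suc_eq_le)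
    qed
    have "f (?d u) (?d v) = (f (?d u) 1 + f 1 (?d v) - f 1 1)
        + (\<Sum>a=1..<M. \<Sum>b=1..<M. D a b * (if (u, v) \<in> level K (Suc a) \<times> level K (Suc b) then 1 else 0))"
      if "(u, v) \<in> adj K" for u v
    proof -
      note uv = adj_in_verts[OF sg that] and pos = degree_pos_if_adj[OF sg that]
      have "(\<Sum>a=1..<M. \<Sum>b=1..<M. D a b * (if (u, v) \<in> level K (Suc a) \<times> level K (Suc b) then 1 else 0))
        = (\<Sum>a=1..<M. \<Sum>b=1..<M. if a < ?d u then (if b < ?d v then D a b else 0) else 0)"
        using uv by (intro sum.cong refl) (auto simp: level_def Suc_le_eq)
      also have "\<dots> = (\<Sum>a=1..<M. if a < ?d u then (\<Sum>b=1..<M. if b < ?d v then D a b else 0) else 0)"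
        by (intro sum.cong refl) auto
      also have "\<dots> = (\<Sum>a=1..<?d u. \<Sum>b=1..<?d v. D a b)"
      proof -
        have *: "{1..<M} \<inter> {a. a < ?d w} = {1..<?d w}" if "w \<in> verts K" for w
          using le[OF that] by auto
        show ?thesis using *[OF uv(1)] *[OF uv(2)] by (simp add: sum.If_cases)
      qed
      also have "\<dots> = f (?d u) (?d v) - f (?d u) 1 - f 1 (?d v) + f 1 1"
        unfolding D_def by (rule double_telescope[OF pos])
      finally show ?thesis by simp
    qed
    then have "(\<Sum>(u, v)\<in>adj K. f (?d u) (?d v)) = (\<Sum>(u, v)\<in>adj K. (f (?d u) 1 + f 1 (?d v) - f 1 1)
        + (\<Sum>a=1..<M. \<Sum>b=1..<M. D a b * (if (u, v) \<in> level K (Suc a) \<times> level K (Suc b) then 1 else 0)))"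
      by (intro sum.cong refl) auto
    also have "\<dots> = (\<Sum>(u, v)\<in>adj K. f (?d u) 1 + f 1 (?d v) - f 1 1)
       + (\<Sum>x\<in>adj K. \<Sum>a=1..<M. \<Sum>b=1..<M. D a b * (if x \<in> level K (Suc a) \<times> level K (Suc b) then 1 else 0))"
      by (simp add: case_prod_unfold sum.distrib mem_Times_iff)
    also have "(\<Sum>(u, v)\<in>adj K. f (?d u) 1 + f 1 (?d v) - f 1 1) = C"
    proof -
      have "(\<Sum>(u, v)\<in>adj K. f (?d u) 1 + f 1 (?d v) - f 1 1)
        = (\<Sum>(u, v)\<in>adj K. f (?d u) 1 - f 1 1) + (\<Sum>(u, v)\<in>adj K. f 1 (?d v))"
        unfolding sum.distrib[symmetric] by (intro sum.cong) auto
      also have "(\<Sum>(u, v)\<in>adj K. f 1 (?d v)) = (\<Sum>(u, v)\<in>adj K. f 1 (?d u))"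
        by (rule sum_adj_swap)
      also have "(\<Sum>(u, v)\<in>adj K. f (?d u) 1 - f 1 1) + \<dots>
        = (\<Sum>u\<in>verts K. real (?d u) * (f (?d u) 1 + f 1 (?d u) - f 1 1))"
        unfolding sum_adj_fst[OF sg] sum.distrib[symmetric]
        by (intro sum.cong) (auto simp: algebra_simps)
      also have "\<dots> = C" unfolding C_def using graph_class_sum[OF K, of "\<lambda>d. real d * (f d 1 + f 1 d - f 1 1)"] .
      finally show ?thesis .
    qed
    also have "(\<Sum>x\<in>adj K. \<Sum>a=1..<M. \<Sum>b=1..<M. D a b * (if x \<in> level K (Suc a) \<times> level K (Suc b) then 1 else 0))
      = (\<Sum>a=1..<M. \<Sum>b=1..<M. \<Sum>x\<in>adj K. D a b * (if x \<in> level K (Suc a) \<times> level K (Suc b) then 1 else 0))"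
      by (subst sum.swap, intro sum.cong refl, rule sum.swap)
    also have "\<dots> = (\<Sum>a=1..<M. \<Sum>b=1..<M. D a b * real (card (arcs_between K (level K (Suc a)) (level K (Suc b)))))"
      using finite_adj[OF sg]
      by (intro sum.cong refl) (simp add: sum_distrib_left[symmetric] arcs_between_def sum.If_cases del: mem_Sigma_iff)
    finally show ?thesis .
  qed
  have "(\<Sum>a=1..<M. \<Sum>b=1..<M. D a b * real (card (arcs_between H (level H (Suc a)) (level H (Suc b)))))
    \<le> (\<Sum>a=1..<M. \<Sum>b=1..<M. D a b * real (card (arcs_between G (level G (Suc a)) (level G (Suc b)))))"
    by (intro sum_mono mult_left_mono) (use arcs super in \<open>auto simp: D_def\<close>)
  then show ?thesis by (simp add: decomp[OF G] decomp[OF H])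
qed

text \<open>The condition on \<open>\<sigma>\<close> says that
  \<open>\<sigma> * t powr \<alpha>\<close> is convex for positive \<open>t\<close>, so its
  increments over steps of fixed length \<open>w\<close> do not decrease. The sign
  \<open>\<sigma>\<close> lets one statement serve both the maximum and the minimum.\<close>

lemma powr_increment_mono:
  fixes s u w \<alpha> :: real
  assumes "0 < s" "0 \<le> u" "0 \<le> w" "0 \<le> \<sigma> * \<alpha> * (\<alpha> - 1)"
  shows "0 \<le> \<sigma> * ((s + u + w) powr \<alpha> - (s + u) powr \<alpha> - (s + w) powr \<alpha> + s powr \<alpha>)"
proof -
  define k where "k t = \<sigma> * ((t + w) powr \<alpha> - t powr \<alpha>)" for t
  have "k s \<le> k (s + u)"
  proof (rule DERIV_nonneg_imp_nondecreasing[of s "s + u" k])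
    show "s \<le> s + u" using assms by simp
    fix t assume "s \<le> t" "t \<le> s + u"
    then have t: "0 < t" using assms by simp
    have "(k has_real_derivative \<sigma> * (\<alpha> * (t + w) powr (\<alpha> - 1) - \<alpha> * t powr (\<alpha> - 1))) (at t)"
      unfolding k_def using t assms(3) by (auto intro!: derivative_eq_intros)
    moreover have "0 \<le> \<sigma> * (\<alpha> * (t + w) powr (\<alpha> - 1) - \<alpha> * t powr (\<alpha> - 1))"
    \<comment> \<open>The sign of \<open>\<alpha> - 1\<close> decides whether
      \<open>t powr (\<alpha> - 1)\<close> rises or falls, and the hypothesis then fixes the sign of
      \<open>\<sigma> * \<alpha>\<close>. At \<open>\<alpha> = 1\<close> it fixes nothing, but there
      the difference vanishes.\<close>
    proof (cases "\<alpha> \<ge> 1")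
      case True
      have "t powr (\<alpha> - 1) \<le> (t + w) powr (\<alpha> - 1)" using True t assms(3) by (intro powr_mono2) auto
      moreover have "\<alpha> = 1 \<or> 0 \<le> \<sigma> * \<alpha>"
        using assms(4) True by (auto simp: zero_le_mult_iff mult_le_0_iff)
      moreover have "t + w \<noteq> 0" using t assms(3) by simp
      ultimately show ?thesis using t
        by (elim disjE) (simp_all add: mult.assoc[symmetric] right_diff_distrib mult_left_mono)
    next
      case False
      have "(t + w) powr (\<alpha> - 1) \<le> t powr (\<alpha> - 1)" using False t assms(3) by (intro powr_mono2') auto
      moreover have "\<sigma> * \<alpha> \<le> 0"
        using assms(4) False by (auto simp: zero_le_mult_iff mult_le_0_iff)
      ultimately show ?thesis
        by (auto simp: mult.assoc[symmetric] right_diff_distrib intro!: mult_left_mono_neg)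
    qed
    ultimately show "\<exists>y. (k has_real_derivative y) (at t) \<and> 0 \<le> y" by blast
  qed
  then show ?thesis by (simp add: k_def algebra_simps)
qed

lemma SO_eq_sum_adj:
  assumes "simple_graph G"
  shows "2 * SO \<alpha> G = (\<Sum>(u, v)\<in>adj G. (real (degree G u) ^ 2 + real (degree G v) ^ 2) powr \<alpha>)"
proof -
  have "(\<Sum>(u, v)\<in>adj G. (real (degree G u) ^ 2 + real (degree G v) ^ 2) powr \<alpha>)
    = (\<Sum>(u, v)\<in>adj G. (\<Sum>w\<in>{u, v}. (real (degree G w))\<^sup>2) powr \<alpha>)"
  proof (rule sum.cong[OF refl], clarify)
    fix u v assume "(u, v) \<in> adj G"
    then have "u \<noteq> v" using adj_in_verts(3)[OF assms] by metis
    then show "(real (degree G u) ^ 2 + real (degree G v) ^ 2) powr \<alpha>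
      = (\<Sum>w\<in>{u, v}. (real (degree G w))\<^sup>2) powr \<alpha>" by simp
  qed
  then show ?thesis
    using sum_adj_of_edge[OF assms, of "\<lambda>e. (\<Sum>w\<in>e. (real (degree G w))\<^sup>2) powr \<alpha>"]
    by (simp add: SO_def)
qed

text \<open>Only \<open>b \<le> a\<close> has to be checked, because reversing arcs exchanges the
  two levels. This makes the levels nested, as the counting of arcs requires.\<close>

lemma precisely_extremalI:
  fixes G :: "'a ugraph"
  assumes G: "G \<in> graph_class \<pi>"
    and arcs: "\<And>H :: 'a ugraph. \<And>a b. H \<in> graph_class \<pi> \<Longrightarrow> b \<le> a \<Longrightarrow>
      card (arcs_between H (level H a) (level H b)) \<le> card (arcs_between G (level G a) (level G b))"
  shows "precisely_extremal \<pi> G"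
proof -
  have main: "\<sigma> * SO \<alpha> H \<le> \<sigma> * SO \<alpha> G"
    if H: "H \<in> graph_class \<pi>" and \<sigma>: "0 \<le> \<sigma> * \<alpha> * (\<alpha> - 1)" for \<sigma> \<alpha> :: real and H :: "'a ugraph"
  proof -
    define f where "f x y = \<sigma> * (real x ^ 2 + real y ^ 2) powr \<alpha>" for x y :: nat
    have "(\<Sum>(u, v)\<in>adj H. f (degree H u) (degree H v)) \<le> (\<Sum>(u, v)\<in>adj G. f (degree G u) (degree G v))"
    proof (rule sum_adj_supermodular_mono[OF G H])
      show "card (arcs_between H (level H a) (level H b)) \<le> card (arcs_between G (level G a) (level G b))"
        for a b
        using arcs[OF H, of a b] arcs[OF H, of b a]
        by (metis card_arcs_between_commute nat_le_linear)
      fix a b :: nat assume ab: "1 \<le> a" "1 \<le> b"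
      \<comment> \<open>Raising \<open>a\<close> and \<open>b\<close> by one adds
        \<open>2 * a + 1\<close> and \<open>2 * b + 1\<close> to the sum of squares independently,
        so the mixed difference of \<open>f\<close> is a second difference of a power.\<close>
      have "0 \<le> \<sigma> * ((real a ^ 2 + real b ^ 2 + (2 * real a + 1) + (2 * real b + 1)) powr \<alpha>
        - (real a ^ 2 + real b ^ 2 + (2 * real a + 1)) powr \<alpha>
        - (real a ^ 2 + real b ^ 2 + (2 * real b + 1)) powr \<alpha> + (real a ^ 2 + real b ^ 2) powr \<alpha>)"
        by (rule powr_increment_mono[OF _ _ _ \<sigma>]) (use ab in \<open>auto simp: add_pos_pos\<close>)
      then show "0 \<le> f (Suc a) (Suc b) - f a (Suc b) - f (Suc a) b + f a b"
        unfolding f_def by (simp add: power2_eq_square algebra_simps)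
    qed
    moreover have "(\<Sum>(u, v)\<in>adj K. f (degree K u) (degree K v)) = 2 * (\<sigma> * SO \<alpha> K)"
      if "simple_graph K" for K :: "'a ugraph"
      using SO_eq_sum_adj[OF that, of \<alpha>] by (simp add: f_def case_prod_unfold sum_distrib_left[symmetric])
    ultimately show ?thesis using graph_class_simple[OF G] graph_class_simple[OF H] by simp
  qed
  show ?thesis unfolding precisely_extremal_def
  proof (intro conjI allI impI ballI)
    show "G \<in> graph_class \<pi>" by (rule G)
    fix \<alpha> :: real and H :: "'a ugraph" assume H: "H \<in> graph_class \<pi>"
    show "SO \<alpha> G \<le> SO \<alpha> H" if "0 < \<alpha> \<and> \<alpha> < 1"
      \<comment> \<open>For \<open>\<alpha>\<close> between 0 and 1 the power is concave; negating
        it turns the minimum into a maximum.\<close>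
      using main[OF H, of "-1" \<alpha>] that by (simp add: mult_le_0_iff zero_le_mult_iff)
    show "SO \<alpha> H \<le> SO \<alpha> G" if "1 < \<alpha> \<or> \<alpha> < 0"
      using main[OF H, of 1 \<alpha>] that by (auto simp: mult_le_0_iff zero_le_mult_iff)
  qed
qed

section \<open>Greedy graphs\<close>

text \<open>The first vertex is the root, \<open>par j\<close> is the parent of the \<open>j\<close>-th vertex, and the \<open>c\<close> edges
  outside of the tree join the second vertex to the \<open>c\<close> vertices following it.\<close>

definition index_edges :: "nat \<Rightarrow> nat \<Rightarrow> (nat \<Rightarrow> nat) \<Rightarrow> (nat \<times> nat) set" where
  "index_edges c n par = (\<lambda>j. (par j, j)) ` {2..n} \<union> Pair 2 ` {3..c + 2}"

text \<open>With \<open>par j = 1\<close> up to \<open>c + 2\<close>, every extra edge closes a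
  triangle with the root and differs from all tree edges.\<close>

definition parent_map :: "nat \<Rightarrow> nat \<Rightarrow> (nat \<Rightarrow> nat) \<Rightarrow> bool" where
  "parent_map c n par \<longleftrightarrow> c + 2 \<le> n \<and> (\<forall>j\<in>{2..c + 2}. par j = 1) \<and>
     (\<forall>j\<in>{2..n}. 1 \<le> par j \<and> par j < j)"

text \<open>Monotonicity of \<open>par\<close> expresses breadth-first search: the children of an
  earlier vertex come first. Degrees are kept out and enter as a separate assumption where
  needed.\<close>

definition greedy :: "nat \<Rightarrow> 'a ugraph \<Rightarrow> (nat \<Rightarrow> 'a) \<Rightarrow> (nat \<Rightarrow> nat) \<Rightarrow> bool" where
  "greedy c G v par \<longleftrightarrow> bij_betw v {1..card (verts G)} (verts G) \<and> parent_map c (card (verts G)) par \<and>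
     mono_on {2..card (verts G)} par \<and> edges G = (\<lambda>(i, j). {v i, v j}) ` index_edges c (card (verts G)) par"

lemma parent_map_one: "parent_map c n par \<Longrightarrow> 2 \<le> j \<Longrightarrow> j \<le> c + 2 \<Longrightarrow> par j = 1"
  by (simp add: parent_map_def)

lemma index_edges_bounds:
  assumes "parent_map c n par" "(i, j) \<in> index_edges c n par"
  shows "1 \<le> i" "i < j" "j \<le> n"
  using assms by (auto simp: parent_map_def index_edges_def)

lemma finite_index_edges: "finite (index_edges c n par)"
  by (simp add: index_edges_def)

text \<open>Initial segments attain the edge bound. The larger index stands second, so a pair lies
  inside the segment as soon as its second entry does.\<close>

lemma card_index_edges_upto:
  assumes "parent_map c n par" "1 \<le> p" "p \<le> n"
  shows "card {(i, j) \<in> index_edges c n par. j \<le> p} = edge_bound c p"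
proof -
  have "{(i, j) \<in> index_edges c n par. j \<le> p}
    = (\<lambda>j. (par j, j)) ` {2..p} \<union> Pair 2 ` {3..min (c + 2) p}"
    using assms by (auto simp: index_edges_def)
  moreover have "(\<lambda>j. (par j, j)) ` {2..p} \<inter> Pair 2 ` {3..min (c + 2) p} = {}"
    using parent_map_one[OF assms(1)] by fastforce
  moreover have "card ((\<lambda>j. (par j, j)) ` {2..p}) = p - 1"
    by (subst card_image) (auto simp: inj_on_def)
  moreover have "card (Pair (2::nat) ` {3..min (c + 2) p}) = min c (p - 2)"
    by (subst card_image) (auto simp: inj_on_def)
  ultimately show ?thesis by (simp add: card_Un_disjoint edge_bound_def)
qed

lemma inj_on_index_edges:
  assumes "parent_map c n par" "inj_on v {1..n}"
  shows "inj_on (\<lambda>(i, j). {v i, v j}) (index_edges c n par)"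
proof (rule inj_onI, clarify)
  fix i j k l assume ij: "(i, j) \<in> index_edges c n par" and kl: "(k, l) \<in> index_edges c n par"
    and eq: "{v i, v j} = {v k, v l}"
  note b = index_edges_bounds[OF assms(1) ij] index_edges_bounds[OF assms(1) kl]
  have "v i = v k \<and> v j = v l \<or> v i = v l \<and> v j = v k" using eq by (simp add: doubleton_eq_iff)
  then have "i = k \<and> j = l \<or> i = l \<and> j = k"
    using b inj_on_eq_iff[OF assms(2)] by auto
  then show "i = k \<and> j = l" using b by auto
qed

lemma greedy_arcs_ge:
  assumes g: "greedy c G v par" and sg: "simple_graph G" and pq: "1 \<le> p" "p \<le> q" "q \<le> card (verts G)"
    and A: "A = v ` {1..p}" and B: "B = v ` {1..q}"
  shows "(\<Sum>u\<in>A. degree G u) \<le> card (arcs_between G A B) \<or>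
    edge_bound c p + (if p = 1 then q - 1 else edge_bound c q) \<le> card (arcs_between G A B)"
proof -
  define n where "n = card (verts G)"
  define P where "P = index_edges c n par"
  let ?e = "\<lambda>(i, j). {v i, v j}"
  have bij: "bij_betw v {1..n} (verts G)" and pm: "parent_map c n par"
    and mono_par: "mono_on {2..n} par" and E: "edges G = ?e ` P"
    using g by (auto simp: greedy_def n_def P_def)
  have inj: "inj_on v {1..n}" using bij by (simp add: bij_betw_def)
  have injP: "inj_on ?e P" unfolding P_def by (rule inj_on_index_edges[OF pm inj])
  have AB: "A \<subseteq> B" "A \<subseteq> verts G" "B \<subseteq> verts G"
    using pq bij by (auto simp: A B n_def bij_betw_def)
  have finE: "finite (edges G)" by (rule simple_graph_finite_edges[OF sg])
  have ge: "card Q \<le> card F" if "Q \<subseteq> P" "?e ` Q \<subseteq> F" "F \<subseteq> edges G" for Q F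
  proof -
    have "card Q = card (?e ` Q)" by (metis card_image inj_on_subset injP that(1))
    also have "\<dots> \<le> card F" by (rule card_mono) (use that finE finite_subset in auto)
    finally show ?thesis .
  qed
  show ?thesis
  \<comment> \<open>If all parents of \<open>B\<close> lie in \<open>A\<close>, every tree edge
    inside \<open>B\<close> meets \<open>A\<close> and the edge bound is attained; otherwise
    \<open>A\<close> has no neighbour outside \<open>B\<close>.\<close>
  proof (cases "\<forall>j\<in>{2..q}. par j \<le> p")
    case True
    have "card {(i, j) \<in> P. j \<le> p} \<le> card (edges_in G A)"
    proof (rule ge)
      show "?e ` {(i, j) \<in> P. j \<le> p} \<subseteq> edges_in G A"
        using index_edges_bounds[OF pm] by (fastforce simp: edges_in_def E A P_def)
    qed (auto simp: edges_in_def)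
    then have 1: "edge_bound c p \<le> card (edges_in G A)"
      using card_index_edges_upto[OF pm pq(1)] pq by (simp add: P_def n_def)
    have "card {(i, j) \<in> P. i \<le> p \<and> j \<le> q} \<le> card {e \<in> edges_in G B. e \<inter> A \<noteq> {}}"
    proof (rule ge)
      show "?e ` {(i, j) \<in> P. i \<le> p \<and> j \<le> q} \<subseteq> {e \<in> edges_in G B. e \<inter> A \<noteq> {}}"
        using index_edges_bounds[OF pm] by (fastforce simp: edges_in_def E A B P_def)
    qed (auto simp: edges_in_def)
    moreover have "(if p = 1 then q - 1 else edge_bound c q) \<le> card {(i, j) \<in> P. i \<le> p \<and> j \<le> q}"
    \<comment> \<open>For \<open>p = 1\<close> the extra edges start outside \<open>A\<close>, and
      only the \<open>q - 1\<close> tree edges are counted; for larger \<open>p\<close> their common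
      end, the second vertex, lies in \<open>A\<close>.\<close>
    proof (cases "p = 1")
      case p: True
      have "card ((\<lambda>j. (par j, j)) ` {2..q}) \<le> card {(i, j) \<in> P. i \<le> p \<and> j \<le> q}"
        by (rule card_mono)
          (use True pq finite_index_edges in \<open>auto simp: P_def index_edges_def n_def intro: finite_subset[of _ P]\<close>)
      moreover have "card ((\<lambda>j. (par j, j)) ` {2..q}) = q - 1"
        by (subst card_image) (auto simp: inj_on_def)
      ultimately show ?thesis using p by simp
    next
      case False
      have "{(i, j) \<in> P. i \<le> p \<and> j \<le> q} = {(i, j) \<in> P. j \<le> q}"
        using True False pq by (auto simp: P_def index_edges_def)
      then show ?thesis using card_index_edges_upto[OF pm, of q] False pq by (simp add: P_def n_def)
    qed
    ultimately show ?thesis using 1 card_arcs_between[OF sg AB(1)] by linarith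
  next
    case False
    then obtain j where j: "2 \<le> j" "j \<le> q" "p < par j" by auto
    have jn: "j \<le> n" using j pq by (simp add: n_def)
    have "c + 2 < j" using parent_map_one[OF pm, of j] j pq by fastforce
    \<comment> \<open>An edge ending beyond \<open>j\<close> would be a tree edge, as
      \<open>j\<close> is past the extra edges; by monotonicity its parent index is at least
      \<open>par j\<close>, hence larger than \<open>p\<close>.\<close>
    have key: "l \<le> q" if "(i, l) \<in> P" "i \<le> p" for i l
    proof -
      have mono: "par j \<le> par l" if "j \<le> l" "l \<le> n"
        using mono_onD[OF mono_par, of j l] that j by auto
      have "l \<le> j"
      proof (rule ccontr)
        assume "\<not> l \<le> j"
        then have "i = par l" "l \<le> n"
          using \<open>(i, l) \<in> P\<close> \<open>c + 2 < j\<close> pm by (auto simp: P_def index_edges_def parent_map_def)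
        then show False using mono \<open>\<not> l \<le> j\<close> \<open>i \<le> p\<close> j by simp
      qed
      then show ?thesis using j by simp
    qed
    have "nbhd G u \<subseteq> B" if u: "u \<in> A" for u
    proof
      fix w assume "w \<in> nbhd G u"
      then obtain i l where il: "(i, l) \<in> P" "{u, w} = {v i, v l}" by (auto simp: nbhd_def E)
      obtain k where k: "u = v k" "1 \<le> k" "k \<le> p" using u by (auto simp: A)
      note b = index_edges_bounds[OF pm, of i l] il(1)[unfolded P_def]
      consider "u = v i" "w = v l" | "u = v l" "w = v i" using il(2) by (auto simp: doubleton_eq_iff)
      then show "w \<in> B"
      proof cases
        case 1
        then have "k = i" using k b pq by (intro inj_onD[OF inj]) (auto simp: n_def)
        then show ?thesis using key[OF il(1)] k b 1 by (auto simp: B)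
      next
        case 2
        then have "k = l" using k b pq by (intro inj_onD[OF inj]) (auto simp: n_def)
        then show ?thesis using k b 2 pq by (auto simp: B)
      qed
    qed
    then have "card (arcs_between G A B) = (\<Sum>u\<in>A. degree G u)"
      unfolding card_arcs_from[OF sg AB(2)] degree_def
      by (intro sum.cong refl) (simp add: Int_absorb2)
    then show ?thesis by simp
  qed
qed

lemma arcs_between_levels_le:
  fixes G H :: "'a ugraph"
  assumes c: "c \<le> 2" and cyc: "c_cyclic c G" and G: "G \<in> graph_class \<pi>" and H: "H \<in> graph_class \<pi>"
    and ab: "b \<le> a" and p: "p = card (level G a)" and q: "q = card (level G b)"
  shows "card (arcs_between H (level H a) (level H b)) \<le> (\<Sum>u\<in>level G a. degree G u)"
    and "card (arcs_between H (level H a) (level H b))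
      \<le> edge_bound c p + (if p = 1 then q - 1 else edge_bound c q)"
proof -
  let ?A = "level H a" and ?B = "level H b"
  note sgH = graph_class_simple[OF H]
  have cycH: "c_cyclic c H" by (rule graph_class_c_cyclic[OF G H cyc])
  have sub: "?A \<subseteq> ?B" "?B \<subseteq> verts H" "?A \<subseteq> verts H" using ab by (auto simp: level_def)
  have pH: "p = card ?A" and qH: "q = card ?B" using graph_class_card_level[OF G H] p q by auto
  show "card (arcs_between H ?A ?B) \<le> (\<Sum>u\<in>level G a. degree G u)"
    using card_arcs_between_le_degree_sum[OF sgH sub(3), of ?B] graph_class_level_sum[OF G H, of "\<lambda>x. x" a]
    by simp
  show "card (arcs_between H ?A ?B) \<le> edge_bound c p + (if p = 1 then q - 1 else edge_bound c q)"
  proof (cases "?A = {}")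
    case True
    then show ?thesis by (simp add: arcs_between_def)
  next
    case False
    have "card (arcs_between H ?A ?B) \<le> edge_bound c p + edge_bound c q"
      unfolding pH qH by (rule card_arcs_between_le_edge_bound[OF cycH c sub(1,2) False])
    moreover have "card (arcs_between H ?A ?B) \<le> q - 1" if p1: "p = 1"
    proof -
      obtain u where u: "?A = {u}" using p1 unfolding pH by (auto simp: card_1_singleton_iff)
      then show ?thesis
        using card_arcs_from_singleton_le[OF sgH _ sub(2), of u] sub(1) by (simp add: qH)
    qed
    ultimately show ?thesis by auto
  qed
qed

text \<open>Both upper bounds hold for every competitor, so for each pair of levels it is enough
  that the candidate attains either of them.\<close>

lemma precisely_extremal_criterion:
  fixes G :: "'a ugraph"
  assumes c: "c \<le> 2" and cyc: "c_cyclic c G" and G: "G \<in> graph_class \<pi>"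
    and attains: "\<And>a b p q. b \<le> a \<Longrightarrow> p = card (level G a) \<Longrightarrow> q = card (level G b) \<Longrightarrow> 1 \<le> p \<Longrightarrow>
      (\<Sum>u\<in>level G a. degree G u) \<le> card (arcs_between G (level G a) (level G b)) \<or>
      edge_bound c p + (if p = 1 then q - 1 else edge_bound c q)
        \<le> card (arcs_between G (level G a) (level G b))"
  shows "precisely_extremal \<pi> G"
proof (rule precisely_extremalI[OF G])
  fix H :: "'a ugraph" and a b :: nat
  assume H: "H \<in> graph_class \<pi>" and ab: "b \<le> a"
  show "card (arcs_between H (level H a) (level H b)) \<le> card (arcs_between G (level G a) (level G b))"
  proof (cases "1 \<le> card (level G a)")
    case True
    show ?thesis
      using attains[OF ab refl refl True] arcs_between_levels_le[OF c cyc G H ab refl refl] by linarith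
  next
    case False
    have "finite (level G a)" using graph_class_simple[OF G] by (simp add: level_def simple_graph_def)
    then have "level G a = {}" using False by (simp add: not_le)
    then show ?thesis using arcs_between_levels_le(1)[OF c cyc G H ab refl refl] by simp
  qed
qed

lemma greedy_precisely_extremal:
  fixes G :: "'a ugraph"
  assumes g: "greedy c G v par" and c: "c \<le> 2" and cyc: "c_cyclic c G" and G: "G \<in> graph_class \<pi>"
    and dec: "\<And>i j. 1 \<le> i \<Longrightarrow> i \<le> j \<Longrightarrow> j \<le> card (verts G) \<Longrightarrow> degree G (v j) \<le> degree G (v i)"
  shows "precisely_extremal \<pi> G"
proof (rule precisely_extremal_criterion[OF c cyc G])
  fix a b p q :: nat
  assume ab: "b \<le> a" and p: "p = card (level G a)" and q: "q = card (level G b)" and p1: "1 \<le> p"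
  note sg = graph_class_simple[OF G]
  define n where "n = card (verts G)"
  have bij: "bij_betw v {1..n} (verts G)" using g by (simp add: greedy_def n_def)
  have lev: "level G x = v ` {1..card (level G x)} \<and> card (level G x) \<le> n" for x
  proof -
    define I where "I = {i \<in> {1..n}. x \<le> degree G (v i)}"
    have L: "level G x = v ` I"
      unfolding level_def I_def bij_betw_imp_surj_on[OF bij, symmetric] by auto
    have "inj_on v I" by (rule inj_on_subset[OF bij_betw_imp_inj_on[OF bij]]) (auto simp: I_def)
    then have cardI: "card (level G x) = card I" by (simp add: L card_image)
    have "I = {1..card I}"
    proof (cases "I = {}")
      case False
      have fin: "finite I" by (simp add: I_def)
      have m: "Max I \<in> I" using False fin by simp
      have "I = {1..Max I}"
      proof
        show "I \<subseteq> {1..Max I}" using fin by (auto simp: I_def)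
        show "{1..Max I} \<subseteq> I"
        proof
          fix i assume i: "i \<in> {1..Max I}"
          then have "degree G (v (Max I)) \<le> degree G (v i)" using m by (intro dec) (auto simp: I_def n_def)
          then show "i \<in> I" using m i by (auto simp: I_def)
        qed
      qed
      then show ?thesis by (metis card_atLeastAtMost diff_Suc_1)
    qed simp
    moreover have "card I \<le> n" using card_mono[of "{1..n}" I] by (fastforce simp: I_def)
    ultimately show ?thesis using L cardI by simp
  qed
  have "finite (level G b)" using sg by (simp add: level_def simple_graph_def)
  then have "p \<le> q" unfolding p q by (rule card_mono) (use ab in \<open>auto simp: level_def\<close>)
  then show "(\<Sum>u\<in>level G a. degree G u) \<le> card (arcs_between G (level G a) (level G b)) \<or>
      edge_bound c p + (if p = 1 then q - 1 else edge_bound c q)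
        \<le> card (arcs_between G (level G a) (level G b))"
    using lev[of a] lev[of b] p q by (intro greedy_arcs_ge[OF g sg p1]) (auto simp: n_def)
qed

section \<open>Breadth-first orderings\<close>

text \<open>With the whole vertex set as \<open>S\<close>, the edge bound says
  \<open>c \<le> min c (n - 2)\<close> for the number \<open>n\<close> of vertices.\<close>

lemma c_cyclic_card_verts:
  assumes "c_cyclic c G" "c \<le> 2" "2 \<le> card (verts G)"
  shows "c + 2 \<le> card (verts G)"
proof -
  have "simple_graph G" using assms(1) by (simp add: c_cyclic_def connected_graph_def)
  then have "edges_in G (verts G) = edges G" by (auto simp: edges_in_def simple_graph_def)
  moreover have "verts G \<noteq> {}" using assms(3) by auto
  ultimately have "card (edges G) \<le> edge_bound c (card (verts G))"
    using card_edges_in_le[OF assms(1,2), of "verts G"] by simp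
  then show ?thesis using assms by (auto simp: edge_bound_def c_cyclic_def min_def split: if_splits)
qed

lemma card_index_edges:
  assumes "parent_map c n par" shows "card (index_edges c n par) + 1 = n + c"
proof -
  have n: "c + 2 \<le> n" using assms by (simp add: parent_map_def)
  have "{(i, j) \<in> index_edges c n par. j \<le> n} = index_edges c n par"
    using index_edges_bounds[OF assms] by auto
  then have "card (index_edges c n par) = edge_bound c n"
    using card_index_edges_upto[OF assms, of n] n by simp
  then show ?thesis using n by (simp add: edge_bound_def)
qed

text \<open>Both sides have as many edges as a c-cyclic graph on these vertices, so one inclusion
  forces equality. Only the presence of edges has to be verified, never their absence.\<close>

lemma edges_eq_index_edges:
  assumes "c_cyclic c G" "bij_betw v {1..card (verts G)} (verts G)" "parent_map c (card (verts G)) par"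
    and "(\<lambda>(i, j). {v i, v j}) ` index_edges c (card (verts G)) par \<subseteq> edges G"
  shows "edges G = (\<lambda>(i, j). {v i, v j}) ` index_edges c (card (verts G)) par"
proof -
  have "simple_graph G" using assms(1) by (simp add: c_cyclic_def connected_graph_def)
  then have "finite (edges G)" by (rule simple_graph_finite_edges)
  moreover have "card ((\<lambda>(i, j). {v i, v j}) ` index_edges c (card (verts G)) par) = card (edges G)"
    using card_image[OF inj_on_index_edges[OF assms(3) bij_betw_imp_inj_on[OF assms(2)]]]
      card_index_edges[OF assms(3)] assms(1) by (simp add: c_cyclic_def)
  ultimately show ?thesis using assms(4) card_subset_eq by metis
qed

lemma index_edge_iff:
  assumes "inj_on v {1..n}" "parent_map c n par" "1 \<le> i" "i \<le> n" "1 \<le> j" "j \<le> n"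
  shows "{v i, v j} \<in> (\<lambda>(i, j). {v i, v j}) ` index_edges c n par
    \<longleftrightarrow> (i, j) \<in> index_edges c n par \<or> (j, i) \<in> index_edges c n par"
proof
  assume "{v i, v j} \<in> (\<lambda>(i, j). {v i, v j}) ` index_edges c n par"
  then obtain k l where kl: "(k, l) \<in> index_edges c n par" "{v i, v j} = {v k, v l}" by auto
  note b = index_edges_bounds[OF assms(2) kl(1)]
  have "v i = v k \<and> v j = v l \<or> v i = v l \<and> v j = v k" using kl(2) by (simp add: doubleton_eq_iff)
  then have "i = k \<and> j = l \<or> i = l \<and> j = k"
    using b assms inj_on_eq_iff[OF assms(1)] by auto
  then show "(i, j) \<in> index_edges c n par \<or> (j, i) \<in> index_edges c n par" using kl(1) by auto
qed (force simp: insert_commute)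

section \<open>Distances to the root, and greedy structure of breadth-first orderings\<close>

lemma distance_relpow:
  assumes "connected_graph G" "x \<in> verts G" "r \<in> verts G"
  shows "(x, r) \<in> adj G ^^ distance G x r"
proof -
  have "(x, r) \<in> (adj G)\<^sup>*" using assms by (simp add: connected_graph_def)
  then obtain k where "(x, r) \<in> adj G ^^ k" using rtrancl_imp_relpow by blast
  then show ?thesis unfolding distance_def by (rule LeastI)
qed

lemma distance_le: "(x, r) \<in> adj G ^^ k \<Longrightarrow> distance G x r \<le> k"
  unfolding distance_def by (rule Least_le)

lemma distance_self [simp]: "distance G r r = 0"
  using distance_le[of r r 0 G] by simp

lemma distance_eq_0:
  assumes "connected_graph G" "x \<in> verts G" "r \<in> verts G" "distance G x r = 0"
  shows "x = r"
  using distance_relpow[OF assms(1-3)] assms(4) by simp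

lemma distance_adj_le:
  assumes "connected_graph G" "(x, y) \<in> adj G" "r \<in> verts G"
  shows "distance G x r \<le> Suc (distance G y r)"
proof -
  have "y \<in> verts G" using assms adj_in_verts by (metis connected_graph_def)
  then have "(y, r) \<in> adj G ^^ distance G y r" by (rule distance_relpow[OF assms(1) _ assms(3)])
  then show ?thesis using assms(2) by (intro distance_le relpow_Suc_I2)
qed

lemma distance_predecessor:
  assumes "connected_graph G" "x \<in> verts G" "r \<in> verts G" "x \<noteq> r"
  obtains y where "(x, y) \<in> adj G" "distance G x r = distance G y r + 1"
proof -
  obtain k where k: "distance G x r = Suc k"
    using distance_eq_0[OF assms(1-3)] assms(4) not0_implies_Suc by blast
  then have "(x, r) \<in> adj G ^^ Suc k" using distance_relpow[OF assms(1-3)] by simp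
  then obtain y where y: "(x, y) \<in> adj G" "(y, r) \<in> adj G ^^ k" using relpow_Suc_D2 by metis
  have "distance G y r \<le> k" "distance G x r \<le> Suc (distance G y r)"
    using distance_le[OF y(2)] distance_adj_le[OF assms(1) y(1) assms(3)] by auto
  then show thesis using that[OF y(1)] k by simp
qed

text \<open>Any neighbour one step closer to the root may serve as parent. Counting edges shows that
  the parent edges and the extra edges are all of \<open>G\<close>, which makes non-adjacency
  available for the exchange clause of the ordering.\<close>

lemma bfs_ordering_greedy:
  assumes bfs: "bfs_ordering G v" and cyc: "c_cyclic c G" and n: "c + 2 \<le> card (verts G)"
    and extra: "\<And>k. k \<in> {3..c + 2} \<Longrightarrow> {v 1, v k} \<in> edges G \<and> {v 2, v k} \<in> edges G"
  shows "\<exists>par. greedy c G v par"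
proof -
  define n where "n = card (verts G)"
  define h where "h i = distance G (v i) (v 1)" for i
  have con: "connected_graph G" using cyc by (simp add: c_cyclic_def)
  then have sg: "simple_graph G" by (simp add: connected_graph_def)
  have bij: "bij_betw v {1..n} (verts G)"
    and mono_h: "\<And>i j. 1 \<le> i \<Longrightarrow> i \<le> j \<Longrightarrow> j \<le> n \<Longrightarrow> h i \<le> h j"
    and swap: "\<And>i j k l. i \<in> {1..n} \<Longrightarrow> j \<in> {1..n} \<Longrightarrow> k \<in> {1..n} \<Longrightarrow> l \<in> {1..n} \<Longrightarrow>
       v j \<in> nbhd G (v i) - nbhd G (v k) \<Longrightarrow> v l \<in> nbhd G (v k) - nbhd G (v i) \<Longrightarrow>
       h j = h i + 1 \<Longrightarrow> h l = h k + 1 \<Longrightarrow> i < k \<Longrightarrow> j < l"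
    using bfs unfolding bfs_ordering_def Let_def n_def[symmetric] h_def by (simp, simp, blast)
  have inj: "inj_on v {1..n}" and sur: "v ` {1..n} = verts G" using bij by (auto simp: bij_betw_def)
  have n2: "c + 2 \<le> n" using assms(3) by (simp add: n_def)
  have v: "v i \<in> verts G" if "1 \<le> i" "i \<le> n" for i using that sur by auto
  have h0: "i = 1" if "1 \<le> i" "i \<le> n" "h i = 0" for i
  proof -
    have "v i = v 1" using that n2 by (intro distance_eq_0[OF con]) (auto simp: h_def intro: v)
    then show ?thesis using that n2 inj_on_eq_iff[OF inj, of i 1] by simp
  qed
  have "\<exists>i. 1 \<le> i \<and> i < j \<and> (v j, v i) \<in> adj G \<and> h j = h i + 1" if j: "2 \<le> j" "j \<le> n" for j
  proof -
    have "v j \<noteq> v 1" using j inj_on_eq_iff[OF inj, of j 1] by simp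
    then obtain y where y: "(v j, y) \<in> adj G" "h j = distance G y (v 1) + 1"
      using distance_predecessor[OF con v[of j] v[of 1]] j n2 unfolding h_def by auto
    then have "y \<in> verts G" using adj_in_verts[OF sg] by blast
    then obtain i where i: "1 \<le> i" "i \<le> n" "y = v i" using sur by fastforce
    then have "h j = h i + 1" using y by (simp add: h_def)
    \<comment> \<open>Otherwise \<open>h j \<le> h i\<close> by monotonicity of the distance along
      the ordering.\<close>
    moreover have "i < j" using mono_h[of j i] \<open>h j = h i + 1\<close> i j by fastforce
    ultimately show ?thesis using i y by blast
  qed
  then obtain par where par:
    "\<And>j. 2 \<le> j \<Longrightarrow> j \<le> n \<Longrightarrow> 1 \<le> par j \<and> par j < j \<and> (v j, v (par j)) \<in> adj G \<and> h j = h (par j) + 1"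
    by metis
  have par1: "par k = 1" if k: "2 \<le> k" "k \<le> c + 2" for k
  proof (cases "k = 2")
    case True then show ?thesis using par[of 2] n2 by simp
  next
    case False
    then have "(v k, v 1) \<in> adj G" using extra[of k] k by (auto simp: adj_def insert_commute)
    then have "h k \<le> 1" using distance_adj_le[OF con, of "v k" "v 1" "v 1"] v n2 by (simp add: h_def)
    then have "h (par k) = 0" "1 \<le> par k" "par k \<le> n" using par[of k] k n2 by auto
    then show ?thesis using h0 by blast
  qed
  have pm: "parent_map c n par" unfolding parent_map_def using n2 par par1 by auto
  have E: "edges G = (\<lambda>(i, j). {v i, v j}) ` index_edges c n par"
    unfolding n_def
  proof (rule edges_eq_index_edges[OF cyc])
    show "bij_betw v {1..card (verts G)} (verts G)" "parent_map c (card (verts G)) par"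
      using bij pm by (auto simp: n_def)
    show "(\<lambda>(i, j). {v i, v j}) ` index_edges c (card (verts G)) par \<subseteq> edges G"
      using par extra by (auto simp: index_edges_def adj_def insert_commute simp flip: n_def)
  qed
  have edge: "(i, j) \<in> index_edges c n par" if "v j \<in> nbhd G (v i)" "1 \<le> i" "i < j" "j \<le> n" for i j
    using that index_edge_iff[OF inj pm, of i j] index_edges_bounds[OF pm, of j i]
    by (auto simp: nbhd_def E)
  have "mono_on {2..n} par"
  proof (rule mono_onI, rule ccontr)
    fix i j assume ij: "i \<in> {2..n}" "j \<in> {2..n}" "i \<le> j" "\<not> par i \<le> par j"
    note pi = par[of i] and pj = par[of j]
    \<comment> \<open>With the parents in the wrong order neither crossing adjacency exists: it is
      no tree edge, and no extra edge because \<open>par\<close> is 1 at both ends of those. The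
      exchange clause then yields \<open>j < i\<close>.\<close>
    have "v j \<notin> nbhd G (v (par i))"
      using edge[of j "par i"] par1[of i] par1[of j] ij pi pj by (auto simp: index_edges_def)
    moreover have "v i \<notin> nbhd G (v (par j))"
      using edge[of i "par j"] par1[of i] ij pi pj by (auto simp: index_edges_def)
    moreover have "v j \<in> nbhd G (v (par j))" "v i \<in> nbhd G (v (par i))"
      using pi pj ij by (auto simp: adj_def nbhd_def insert_commute)
    ultimately have "j < i" using swap[of "par j" j "par i" i] ij pi pj by auto
    then show False using ij by simp
  qed
  then show ?thesis unfolding greedy_def using bij pm E by (auto simp: n_def)
qed

section \<open>Extremality of the graphs that are recognised as greedy\<close>

lemma mset_image_dg: "image_mset (dg \<pi>) (mset_set {1..length \<pi>}) = mset \<pi>"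
proof -
  have "mset_set {1..length \<pi>} = image_mset Suc (mset_set {0..<length \<pi>})"
    by (simp add: image_mset_mset_set image_Suc_atLeastLessThan atLeastLessThanSuc_atLeastAtMost)
  then have "image_mset (dg \<pi>) (mset_set {1..length \<pi>}) = image_mset (\<lambda>i. \<pi> ! i) (mset_set {0..<length \<pi>})"
    by (simp add: image_mset.compositionality comp_def dg_def)
  also have "\<dots> = mset (map (\<lambda>i. \<pi> ! i) [0..<length \<pi>])" by (simp flip: mset_upt)
  finally show ?thesis by (simp add: map_nth)
qed

lemma graph_class_of_ordering:
  assumes "connected_graph G" "bij_betw v {1..length \<pi>} (verts G)"
    and "\<And>i. i \<in> {1..length \<pi>} \<Longrightarrow> degree G (v i) = dg \<pi> i"
  shows "G \<in> graph_class \<pi>"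
proof -
  have "mset_set (verts G) = image_mset v (mset_set {1..length \<pi>})"
    using assms(2) by (auto simp: bij_betw_def image_mset_mset_set)
  then have "image_mset (degree G) (mset_set (verts G)) = image_mset (\<lambda>i. degree G (v i)) (mset_set {1..length \<pi>})"
    by (simp add: image_mset.compositionality comp_def)
  also have "\<dots> = image_mset (dg \<pi>) (mset_set {1..length \<pi>})"
    by (rule image_mset_cong) (use assms(3) in auto)
  finally show ?thesis using assms(1) by (simp only: graph_class_def mset_image_dg mem_Collect_eq simp_thms)
qed

lemma dg_antimono:
  assumes "sorted_wrt (\<ge>) \<pi>" "1 \<le> i" "i \<le> j" "j \<le> length \<pi>"
  shows "dg \<pi> j \<le> dg \<pi> i"
  using assms sorted_wrt_nth_less[OF assms(1), of "i - 1" "j - 1"]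
  by (cases "i = j") (auto simp: dg_def)

lemma T_M_precisely_extremal:
  fixes G :: "'a ugraph"
  assumes "is_T_M \<pi> G" "2 \<le> length \<pi>"
  shows "precisely_extremal \<pi> G"
proof -
  have G: "G \<in> graph_class \<pi>" and cyc: "c_cyclic 0 G" using assms(1) by (auto simp: is_T_M_def)
  obtain v where v: "bfs_ordering G v" using assms(1) by (auto simp: is_T_M_def bfs_graph_def)
  obtain par where g: "greedy 0 G v par"
    using bfs_ordering_greedy[OF v cyc] assms(2) graph_class_card_verts[OF G] by auto
  show ?thesis
    by (rule greedy_precisely_extremal[OF g _ cyc G])
      (use v in \<open>auto simp: bfs_ordering_def Let_def\<close>)
qed

text \<open>Deletion never adds an edge; this transfers the edges of \<open>B1\<close> at the first
  two vertices to \<open>G\<close>.\<close>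

lemma reduced_graph_edges:
  assumes "is_reduced_graph G R" shows "edges R \<subseteq> edges G"
proof -
  have "delete_pendent\<^sup>*\<^sup>* G R" using assms by (simp add: is_reduced_graph_def)
  then show ?thesis
    by (induction rule: rtranclp_induct) (auto simp: delete_pendent_def delete_vertex_def)
qed

lemma B_M_precisely_extremal_of_B1:
  fixes G :: "'a ugraph"
  assumes G: "G \<in> graph_class \<pi>" and cyc: "c_cyclic 2 G" and n: "2 \<le> length \<pi>"
    and v: "bfs_ordering G v" and R: "is_reduced_graph G (B1 (v 1) (v 2) (v 3) (v 4))"
  shows "precisely_extremal \<pi> G"
proof -
  have extra: "{v 1, v k} \<in> edges G \<and> {v 2, v k} \<in> edges G" if "k \<in> {3..2 + 2}" for k
  proof -
    have "k = 3 \<or> k = 4" using that by auto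
    then show ?thesis using reduced_graph_edges[OF R] by (auto simp: B1_def)
  qed
  have "2 + 2 \<le> card (verts G)"
    using c_cyclic_card_verts[OF cyc] n graph_class_card_verts[OF G] by simp
  then obtain par where g: "greedy 2 G v par" using bfs_ordering_greedy[OF v cyc _ extra] by auto
  show ?thesis
    by (rule greedy_precisely_extremal[OF g _ cyc G])
      (use v in \<open>auto simp: bfs_ordering_def Let_def\<close>)
qed

text \<open>The vertices newly appended to each \<open>v i\<close> form an index interval, and these
  intervals follow one another in the order of \<open>i\<close>; hence the parent map is monotone.
  Most of the work ensures that truncated subtraction does not distort the interval ends.\<close>

lemma U_M_precisely_extremal:
  fixes G :: "'a ugraph"
  assumes U: "is_U_M \<pi> G" and n2: "2 \<le> length \<pi>" and dec: "sorted_wrt (\<ge>) \<pi>"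
  shows "precisely_extremal \<pi> G"
proof -
  define n where "n = length \<pi>"
  define d where "d = dg \<pi>"
  define S where "S i = (\<Sum>k=1..i. d k)" for i
  have cyc: "c_cyclic 1 G" using U by (simp add: is_U_M_def)
  then have con: "connected_graph G" and sg: "simple_graph G"
    by (auto simp: c_cyclic_def connected_graph_def)
  obtain v where bij: "bij_betw v {1..n} (verts G)"
    and deg: "\<And>i. i \<in> {1..n} \<Longrightarrow> degree G (v i) = d i"
    and N1: "nbhd G (v 1) = v ` {2..d 1 + 1}"
    and N2: "nbhd G (v 2) = v ` ({1, 3} \<union> {d 1 + 2..d 1 + d 2 - 1})"
    and N3: "nbhd G (v 3) = v ` ({1, 2} \<union> {d 1 + d 2..d 1 + d 2 + d 3 - 3})"
    and N4: "\<And>i. i \<in> {4..n} \<Longrightarrow> \<exists>p\<in>{1..<i}. nbhd G (v i) = v ` ({p} \<union> {S (i - 1) - (i - 2)..S i - i})"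
    using U unfolding is_U_M_def n_def[symmetric] d_def[symmetric] S_def by metis
  have G: "G \<in> graph_class \<pi>"
    by (rule graph_class_of_ordering[OF con]) (use bij deg in \<open>auto simp: n_def d_def\<close>)
  have card: "card (verts G) = n" using graph_class_card_verts[OF G] by (simp add: n_def)
  have n3: "3 \<le> n" using c_cyclic_card_verts[OF cyc] card n2 by (simp add: n_def)
  have inj: "inj_on v {1..n}" using bij by (simp add: bij_betw_def)
  obtain p where p: "\<And>i. i \<in> {4..n} \<Longrightarrow> p i \<in> {1..<i} \<and> nbhd G (v i) = v ` ({p i} \<union> {S (i - 1) - (i - 2)..S i - i})"
    using N4 by metis
  define par where "par j = (if j \<le> 3 then 1 else p j)" for j
  have pm: "parent_map 1 n par" unfolding parent_map_def using n3 p by (auto simp: par_def)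
  have in_nbhd: "v (par j) \<in> nbhd G (v j)" if j: "2 \<le> j" "j \<le> n" for j
  proof -
    consider "j = 2" | "j = 3" | "4 \<le> j" using j by linarith
    then show ?thesis using N2 N3 p[of j] j by cases (auto simp: par_def)
  qed
  have v23: "v 2 \<in> nbhd G (v 3)" "v 1 \<in> nbhd G (v 2)" "v 3 \<in> nbhd G (v 2)" "v 1 \<in> nbhd G (v 3)"
    using N2 N3 by auto
  have "{3..1 + 2} = {3 :: nat}" by auto
  then have P: "index_edges 1 n par = (\<lambda>j. (par j, j)) ` {2..n} \<union> {(2, 3)}"
    unfolding index_edges_def by (simp only: image_insert image_empty)
  have E: "edges G = (\<lambda>(i, j). {v i, v j}) ` index_edges 1 n par"
    unfolding card[symmetric]
  proof (rule edges_eq_index_edges[OF cyc])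
    show "(\<lambda>(i, j). {v i, v j}) ` index_edges 1 (card (verts G)) par \<subseteq> edges G"
      unfolding card P using in_nbhd v23 by (auto simp: nbhd_def insert_commute)
  qed (use bij pm card in auto)
  have pos: "1 \<le> d i" if "i \<in> {1..n}" for i
  proof (cases "i = 1")
    case True
    have "(v 1, v 2) \<in> adj G" using v23 by (auto simp: adj_def nbhd_def insert_commute)
    from degree_pos_if_adj[OF sg this] show ?thesis using deg[OF that] True by simp
  next
    case False
    then have "(v i, v (par i)) \<in> adj G" using in_nbhd[of i] that by (auto simp: adj_iff_nbhd)
    from degree_pos_if_adj[OF sg this] show ?thesis using deg[OF that] by simp
  qed
  have two: "2 \<le> d i" if "i = 2 \<or> i = 3" for i
  proof -
    have "card {v 1, v (5 - i)} \<le> card (nbhd G (v i))"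
      by (rule card_mono[OF finite_nbhd[OF sg]]) (use that v23 in auto)
    moreover have "v 1 \<noteq> v (5 - i)" using that n3 inj_on_eq_iff[OF inj, of 1 "5 - i"] by auto
    ultimately show ?thesis using deg[of i] that n3 by (auto simp: degree_def)
  qed
  \<comment> \<open>Every degree is at least 1, so \<open>S i - i\<close> does not decrease; this
    orders the intervals and, with \<open>S n = 2 * n\<close>, keeps them below
    \<open>n\<close>.\<close>
  have Sstep: "S i + (j - i) \<le> S j" if "i \<le> j" "j \<le> n" for i j
    using that
  proof (induction j rule: dec_induct)
    case (step m)
    then show ?case using pos[of "Suc m"] by (simp add: S_def)
  qed simp
  have Sn: "S n = 2 * n"
  proof -
    have "(\<Sum>u\<in>verts G. degree G u) = (\<Sum>i=1..n. degree G (v i))"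
      using sum.reindex_bij_betw[OF bij, of "degree G"] by simp
    also have "\<dots> = S n" using deg by (simp add: S_def)
    finally show ?thesis using handshake[OF sg] cyc card by (simp add: c_cyclic_def)
  qed
  have S1: "S 1 = d 1" and S2: "S 2 = d 1 + d 2" and S3: "S 3 = d 1 + d 2 + d 3"
    by (auto simp: S_def numeral_2_eq_2 numeral_3_eq_3)
  have S3n: "S 3 \<le> n + 3" using Sstep[of 3 n] Sn n3 by simp
  \<comment> \<open>The ends of the interval of vertices appended to \<open>v i\<close>. The first
    three cases deviate because of the triangle edges.\<close>
  define lo where "lo i = (if i = 1 then 2 else if i = 2 then d 1 + 2 else if i = 3 then d 1 + d 2
    else S (i - 1) - (i - 2))" for i
  define top where "top i = (if i = 1 then d 1 + 1 else if i = 2 then d 1 + d 2 - 1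
    else if i = 3 then d 1 + d 2 + d 3 - 3 else S i - i)" for i
  have top_n: "top i \<le> n" if "i \<in> {1..n}" for i
    using Sstep[of i n] Sn S3n S3 two[of 2] two[of 3] that by (auto simp: top_def)
  have sep: "top a < lo b" if ab: "1 \<le> a" "a < b" "b \<le> n" for a b
  proof (cases "b \<le> 3")
    case True
    then have "a = 1 \<and> b = 2 \<or> a = 1 \<and> b = 3 \<or> a = 2 \<and> b = 3" using that by auto
    then show ?thesis using two[of 2] by (auto simp: top_def lo_def)
  next
    case False
    have 1: "S 3 + (b - 1 - 3) \<le> S (b - 1)" "S a + (b - 1 - a) \<le> S (b - 1)"
      using Sstep[of 3 "b - 1"] Sstep[of a "b - 1"] that False by auto
    consider "a = 1" | "a = 2" | "a = 3" | "4 \<le> a" using ab by linarith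
    then show ?thesis
    proof cases
      case 4
      have "a \<le> S a" using Sstep[of 0 a] that by simp
      then show ?thesis using 1(2) 4 that False by (simp add: top_def lo_def)
    qed (use 1 that False two[of 2] two[of 3] S3 in \<open>auto simp: top_def lo_def\<close>)
  qed
  have block: "lo (par j) \<le> j \<and> j \<le> top (par j)" if j: "2 \<le> j" "j \<le> n" for j
  proof -
    have pj: "1 \<le> par j" "par j < j" using pm j by (auto simp: parent_map_def)
    have nb: "v j \<in> nbhd G (v (par j))" using in_nbhd[OF j] by (simp add: nbhd_def insert_commute)
    \<comment> \<open>The map \<open>v\<close> is injective only on \<open>{1..n}\<close>, so
      membership can be pulled back only after the interval is known to lie there.\<close>
    have mem: "j \<in> I" if I: "v j \<in> v ` I" "I \<subseteq> {1..n}" for I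
    proof -
      obtain k where "k \<in> I" "v j = v k" using I(1) by blast
      then show ?thesis using inj_onD[OF inj, of j k] I(2) j by auto
    qed
    consider "par j = 1" | "par j = 2" | "par j = 3" | "4 \<le> par j" using pj by linarith
    then show ?thesis
    proof cases
      case 1
      have "j \<in> {2..d 1 + 1}" using nb N1 top_n[of 1] n3 1 by (intro mem) (auto simp: top_def)
      then show ?thesis using 1 by (simp add: lo_def top_def)
    next
      case 2
      then have "3 < j" using pj by (auto simp: par_def split: if_splits)
      have "j \<in> {1, 3} \<union> {d 1 + 2..d 1 + d 2 - 1}"
        using nb N2 top_n[of 2] n3 2 by (intro mem) (auto simp: top_def)
      then show ?thesis using 2 \<open>3 < j\<close> by (auto simp: lo_def top_def)
    next
      case 3
      have "j \<in> {1, 2} \<union> {d 1 + d 2..d 1 + d 2 + d 3 - 3}"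
        using nb N3 top_n[of 3] n3 3 two[of 2] by (intro mem) (auto simp: top_def)
      then show ?thesis using 3 pj by (auto simp: lo_def top_def)
    next
      case 4
      let ?i = "par j"
      have i: "?i \<in> {4..n}" using 4 pj j by auto
      \<comment> \<open>Rules out the index 0, on which \<open>v\<close> is not controlled.\<close>
      have "0 < lo ?i" using sep[of 1 ?i] i by simp
      then have "j \<in> {p ?i} \<union> {S (?i - 1) - (?i - 2)..S ?i - ?i}"
        using nb p[OF i] top_n[of ?i] i by (intro mem) (auto simp: top_def lo_def)
      then show ?thesis using i p[OF i] pj by (auto simp: lo_def top_def)
    qed
  qed
  have "mono_on {2..n} par"
  proof (rule mono_onI, rule ccontr)
    fix i j assume ij: "i \<in> {2..n}" "j \<in> {2..n}" "i \<le> j" "\<not> par i \<le> par j"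
    have "1 \<le> par j" "par i < i" using pm ij by (auto simp: parent_map_def)
    then have "top (par j) < lo (par i)" using sep ij by simp
    then show False using block[of i] block[of j] ij by simp
  qed
  then have g: "greedy 1 G v par" unfolding greedy_def card using bij pm E by simp
  show ?thesis
    by (rule greedy_precisely_extremal[OF g _ cyc G])
      (use deg dg_antimono[OF dec] in \<open>auto simp: card n_def d_def\<close>)
qed

section \<open>Construction of greedy graphs\<close>

text \<open>The number of extra edges at the vertex with index \<open>i\<close>.\<close>

definition extra_degree :: "nat \<Rightarrow> nat \<Rightarrow> nat" where
  "extra_degree c i = (if i = 2 then c else if 3 \<le> i \<and> i \<le> c + 2 then 1 else 0)"

text \<open>What remains of the degree after the edge to the parent and the extra edges.\<close>

definition children :: "nat \<Rightarrow> (nat \<Rightarrow> nat) \<Rightarrow> nat \<Rightarrow> nat" where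
  "children c d i = (if i = 1 then d 1 else d i - 1 - extra_degree c i)"

text \<open>The largest index handed out once the first \<open>i\<close> vertices have received
  their children; the summand 1 is the root.\<close>

definition last_child :: "nat \<Rightarrow> (nat \<Rightarrow> nat) \<Rightarrow> nat \<Rightarrow> nat" where
  "last_child c d i = 1 + (\<Sum>k=1..i. children c d k)"

definition bfs_parent :: "nat \<Rightarrow> (nat \<Rightarrow> nat) \<Rightarrow> nat \<Rightarrow> nat" where
  "bfs_parent c d j = (LEAST i. j \<le> last_child c d i)"

lemma last_child_0 [simp]: "last_child c d 0 = 1"
  by (simp add: last_child_def)

lemma last_child_Suc: "last_child c d (Suc i) = last_child c d i + children c d (Suc i)"
  by (simp add: last_child_def)

lemma last_child_mono: "i \<le> j \<Longrightarrow> last_child c d i \<le> last_child c d j"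
  by (induction j rule: dec_induct) (auto simp: last_child_Suc)

text \<open>Here \<open>total\<close> is the handshake identity for \<open>n + c - 1\<close> edges,
  free of subtraction, and \<open>enough\<close> leaves each vertex room for its parent and its
  extra edges.\<close>

locale cyclic_sequence =
  fixes c n :: nat and d :: "nat \<Rightarrow> nat"
  assumes n: "c + 2 \<le> n"
    and dec: "\<And>i j. 1 \<le> i \<Longrightarrow> i \<le> j \<Longrightarrow> j \<le> n \<Longrightarrow> d j \<le> d i"
    and dn: "d n = 1"
    and total: "(\<Sum>k=1..n. d k) + 2 = 2 * (n + c)"
    and enough: "\<And>i. 2 \<le> i \<Longrightarrow> i \<le> n \<Longrightarrow> 1 + extra_degree c i \<le> d i"
begin

abbreviation "s \<equiv> last_child c d"
abbreviation "par \<equiv> bfs_parent c d"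

lemma last_child_n: "s n = n"
proof -
  have split: "{1..n} = insert 1 {2..n}" using n by auto
  have "(\<Sum>k=2..n. children c d k + (1 + extra_degree c k)) = (\<Sum>k=2..n. d k)"
  proof (rule sum.cong[OF refl])
    fix k assume "k \<in> {2..n}"
    then show "children c d k + (1 + extra_degree c k) = d k"
      using enough[of k] by (simp add: children_def)
  qed
  then have "(\<Sum>k=2..n. children c d k) + ((n - 1) + (\<Sum>k=2..n. extra_degree c k)) = (\<Sum>k=2..n. d k)"
    unfolding sum.distrib by simp
  moreover have "(\<Sum>k=2..n. extra_degree c k) = 2 * c"
  proof -
    have "{2..n} = insert 2 {3..n}" using n by auto
    then have "(\<Sum>k=2..n. extra_degree c k) = c + (\<Sum>k=3..n. extra_degree c k)"
      by (simp add: extra_degree_def)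
    also have "(\<Sum>k=3..n. extra_degree c k) = (\<Sum>k=3..c+2. 1)"
      by (rule sum.mono_neutral_cong_right) (use n in \<open>auto simp: extra_degree_def\<close>)
    finally show ?thesis by simp
  qed
  moreover have "s n = 1 + (d 1 + (\<Sum>k=2..n. children c d k))"
    unfolding last_child_def split by (simp add: children_def)
  moreover have "d 1 + (\<Sum>k=2..n. d k) + 2 = 2 * (n + c)" using total unfolding split by simp
  ultimately show ?thesis using n by simp
qed

text \<open>The search never runs dry: vertex \<open>m + 1\<close> has been appended before its
  turn. If its degree is at most 2, each later vertex adds at most one child and the last none, so
  counting back from \<open>s n = n\<close> suffices. Otherwise all earlier degrees are at least 3
  and the surplus persists.\<close>

lemma last_child_ge:
  assumes "1 \<le> m" "m < n" shows "m + 1 \<le> s m"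
proof (cases "d (m + 1) \<le> 2")
  case True
  have "s n \<le> s m + (n - 1 - m)"
  proof -
    have "s l \<le> s m + (l - m)" if "m \<le> l" "l \<le> n" for l
      using that
    proof (induction l rule: dec_induct)
      case (step l)
      have "d (Suc l) \<le> 2" using dec[of "m + 1" "Suc l"] step True by simp
      then have "children c d (Suc l) \<le> 1" using step assms by (simp add: children_def)
      then show ?case using step by (simp add: last_child_Suc)
    qed simp
    from this[of "n - 1"] have "s (n - 1) \<le> s m + (n - 1 - m)" using assms by simp
    moreover have "s n = s (n - 1)" using last_child_Suc[of c d "n - 1"] n dn by (simp add: children_def)
    ultimately show ?thesis by simp
  qed
  then show ?thesis using last_child_n assms by simp
next
  case False
  then have d3: "3 \<le> d k" if "1 \<le> k" "k \<le> m" for k using dec[of k "m + 1"] that assms by simp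
  \<comment> \<open>The stronger start \<open>4 \<le> s 1\<close> pays for the second vertex, whose
    degree may be used up by its parent and the extra edges. From the third vertex on there is at
    least one child each.\<close>
  have "l + 2 \<le> s l \<and> (l = 1 \<longrightarrow> 4 \<le> s l)" if "1 \<le> l" "l \<le> m" for l
    using that
  proof (induction l rule: dec_induct)
    case base
    show ?case using d3[of 1] assms by (simp add: last_child_def children_def)
  next
    case (step l)
    show ?case
    proof (cases "l = 1")
      case True
      then show ?thesis using step by (simp add: last_child_Suc)
    next
      case False
      then have "extra_degree c (Suc l) \<le> 1" using step by (simp add: extra_degree_def)
      then have "1 \<le> children c d (Suc l)" using step False d3[of "Suc l"] by (simp add: children_def)
      then show ?thesis using step by (simp add: last_child_Suc)
    qed
  qed
  from this[of m] show ?thesis using assms by simp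
qed

lemma bfs_parent_eq_iff:
  assumes "2 \<le> j" "j \<le> n" "1 \<le> i"
  shows "par j = i \<longleftrightarrow> s (i - 1) < j \<and> j \<le> s i"
proof
  have ex: "j \<le> s n" using assms last_child_n by simp
  assume i: "par j = i"
  have "j \<le> s i" unfolding i[symmetric] bfs_parent_def by (rule LeastI[of "\<lambda>i. j \<le> s i"]) (rule ex)
  moreover have "\<not> j \<le> s (i - 1)"
    by (rule not_less_Least) (use i assms in \<open>simp add: bfs_parent_def\<close>)
  ultimately show "s (i - 1) < j \<and> j \<le> s i" by simp
next
  assume i: "s (i - 1) < j \<and> j \<le> s i"
  show "par j = i" unfolding bfs_parent_def
  proof (rule Least_equality)
    fix y assume "j \<le> s y"
    show "i \<le> y"
    proof (rule ccontr)
      assume "\<not> i \<le> y"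
      then have "s y \<le> s (i - 1)" by (intro last_child_mono) simp
      then show False using i \<open>j \<le> s y\<close> by simp
    qed
  qed (use i in simp)
qed

lemma bfs_parent_bounds:
  assumes "2 \<le> j" "j \<le> n"
  shows "1 \<le> par j" "par j < j"
proof -
  have "j \<le> s (j - 1)" using last_child_ge[of "j - 1"] assms by simp
  then have "par j \<le> j - 1" unfolding bfs_parent_def by (rule Least_le)
  then show "par j < j" using assms by simp
  have "j \<le> s (par j)"
    unfolding bfs_parent_def by (rule LeastI[of "\<lambda>i. j \<le> s i"]) (rule \<open>j \<le> s (j - 1)\<close>)
  then show "1 \<le> par j" using assms by (cases "par j") auto
qed

lemma parent_map_bfs_parent: "parent_map c n par"
proof -
  have "d 2 \<le> d 1" "1 + c \<le> d 2" using dec[of 1 2] enough[of 2] n by (auto simp: extra_degree_def)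
  \<comment> \<open>The root has at least the degree of the second vertex, so all ends of extra
    edges are children of the root.\<close>
  then have s1: "c + 2 \<le> s 1" by (simp add: last_child_def children_def)
  have "par j = 1" if "j \<in> {2..c + 2}" for j
    using that s1 n by (subst bfs_parent_eq_iff) auto
  then show ?thesis using n bfs_parent_bounds by (auto simp: parent_map_def)
qed

lemma mono_bfs_parent: "mono_on {2..n} par"
proof (rule mono_onI)
  fix i j assume ij: "i \<in> {2..n}" "j \<in> {2..n}" "i \<le> j"
  have "j \<le> s (par j)" using bfs_parent_eq_iff[of j "par j"] bfs_parent_bounds[of j] ij by simp
  then have "i \<le> s (par j)" using ij by simp
  then show "par i \<le> par j" unfolding bfs_parent_def[of c d i] by (rule Least_le)
qed

lemma bfs_children:
  assumes "1 \<le> i" "i \<le> n"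
  shows "{j \<in> {2..n}. par j = i} = {s (i - 1) + 1..s i}" "card {j \<in> {2..n}. par j = i} = children c d i"
proof -
  have "s i \<le> n" "1 \<le> s (i - 1)"
    using last_child_mono[of i n c d] last_child_mono[of 0 "i - 1" c d] last_child_n assms by auto
  then show eq: "{j \<in> {2..n}. par j = i} = {s (i - 1) + 1..s i}"
    using bfs_parent_eq_iff[OF _ _ assms(1)] by fastforce
  show "card {j \<in> {2..n}. par j = i} = children c d i"
    unfolding eq using last_child_Suc[of c d "i - 1"] assms by simp
qed

end

definition index_nbhd :: "nat \<Rightarrow> nat \<Rightarrow> (nat \<Rightarrow> nat) \<Rightarrow> nat \<Rightarrow> nat set" where
  "index_nbhd c n par i = (if i = 1 then {} else {par i}) \<union>
     (if i = 2 then {3..c + 2} else if 3 \<le> i \<and> i \<le> c + 2 then {2} else {}) \<union> {j \<in> {2..n}. par j = i}"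

section \<open>Adjacency, depth and distance in a greedy graph\<close>

context
  fixes c :: nat and G :: "'a ugraph" and v par n
  assumes g: "greedy c G v par" and n_def: "n = card (verts G)"
begin

lemma greedy_facts:
  "bij_betw v {1..n} (verts G)" "inj_on v {1..n}" "parent_map c n par" "mono_on {2..n} par"
  "edges G = (\<lambda>(i, j). {v i, v j}) ` index_edges c n par" "c + 2 \<le> n"
  "\<And>j. 2 \<le> j \<Longrightarrow> j \<le> n \<Longrightarrow> 1 \<le> par j \<and> par j < j"
  using g unfolding greedy_def n_def[symmetric] by (auto simp: bij_betw_def parent_map_def)

lemma greedy_vertex:
  assumes "x \<in> verts G" obtains i where "1 \<le> i" "i \<le> n" "x = v i"
proof -
  have "x \<in> v ` {1..n}" using assms greedy_facts(1) by (simp add: bij_betw_def)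
  then show thesis using that by auto
qed

lemma greedy_simple: "simple_graph G"
proof -
  have v: "v ` {1..n} = verts G" using greedy_facts(1) by (simp add: bij_betw_def)
  have "e \<subseteq> verts G \<and> card e = 2" if e: "e \<in> edges G" for e
  proof -
    obtain i j where ij: "(i, j) \<in> index_edges c n par" "e = {v i, v j}"
      using e greedy_facts(5) by auto
    note b = index_edges_bounds[OF greedy_facts(3) ij(1)]
    have "v i \<noteq> v j" using inj_on_eq_iff[OF greedy_facts(2), of i j] b by auto
    then show ?thesis using b v ij(2) by auto
  qed
  moreover have "finite (verts G)" "verts G \<noteq> {}"
    unfolding v[symmetric] using greedy_facts(6) by auto
  ultimately show ?thesis by (simp add: simple_graph_def)
qed

lemma greedy_nbhd:
  assumes "1 \<le> i" "i \<le> n"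
  shows "nbhd G (v i) = v ` index_nbhd c n par i"
proof -
  have iff: "j \<in> index_nbhd c n par i \<longleftrightarrow> (i, j) \<in> index_edges c n par \<or> (j, i) \<in> index_edges c n par" for j
    using assms greedy_facts(6) by (auto simp: index_nbhd_def index_edges_def image_iff)
  show ?thesis
  proof
    show "nbhd G (v i) \<subseteq> v ` index_nbhd c n par i"
    proof
      fix w assume w: "w \<in> nbhd G (v i)"
      then have "w \<in> verts G" using nbhd_subset[OF greedy_simple] by auto
      then obtain j where j: "1 \<le> j" "j \<le> n" "w = v j" by (rule greedy_vertex)
      then show "w \<in> v ` index_nbhd c n par i"
        using w index_edge_iff[OF greedy_facts(2,3) assms j(1,2)] iff
        by (auto simp: nbhd_def greedy_facts(5))
    qed
    show "v ` index_nbhd c n par i \<subseteq> nbhd G (v i)"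
      using iff by (force simp: nbhd_def greedy_facts(5) insert_commute)
  qed
qed

lemma greedy_degree:
  assumes "1 \<le> i" "i \<le> n"
  shows "degree G (v i) = (if i = 1 then 0 else 1) + extra_degree c i + card {j \<in> {2..n}. par j = i}"
proof -
  note one = parent_map_one[OF greedy_facts(3)]
  have sub: "index_nbhd c n par i \<subseteq> {1..n}"
    using assms greedy_facts(6) greedy_facts(7)[of i] by (auto simp: index_nbhd_def)
  have "degree G (v i) = card (index_nbhd c n par i)"
    unfolding degree_def greedy_nbhd[OF assms] by (rule card_image, rule inj_on_subset[OF greedy_facts(2) sub])
  also have "\<dots> = card ((if i = 1 then {} else {par i}) \<union>
     (if i = 2 then {3..c + 2} else if 3 \<le> i \<and> i \<le> c + 2 then {2} else {})) + card {j \<in> {2..n}. par j = i}"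
    unfolding index_nbhd_def
  proof (rule card_Un_disjoint)
    have "\<not> (j = par i \<and> par j = i)" if "2 \<le> j" "j \<le> n" "2 \<le> i" for j
      using greedy_facts(7)[OF that(1,2)] greedy_facts(7)[of i] that assms by auto
    then show "((if i = 1 then {} else {par i}) \<union>
     (if i = 2 then {3..c + 2} else if 3 \<le> i \<and> i \<le> c + 2 then {2} else {})) \<inter> {j \<in> {2..n}. par j = i} = {}"
      using one one[of 2] assms by auto
  qed auto
  also have "card ((if i = 1 then {} else {par i}) \<union>
     (if i = 2 then {3..c + 2} else if 3 \<le> i \<and> i \<le> c + 2 then {2} else {}))
     = (if i = 1 then 0 else 1) + extra_degree c i"
    using one[of i] assms by (auto simp: extra_degree_def card_insert_if)
  finally show ?thesis .
qed

definition depth :: "nat \<Rightarrow> nat" where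
  "depth j = (LEAST k. (par ^^ k) j = 1)"

lemma depth_1 [simp]: "depth 1 = 0" "depth (Suc 0) = 0"
  by (auto simp: depth_def Least_eq_0)

lemma depth_par:
  assumes "2 \<le> j" "j \<le> n" shows "depth j = Suc (depth (par j))"
proof -
  have "1 \<le> i \<Longrightarrow> i \<le> n \<Longrightarrow> \<exists>k. (par ^^ k) i = 1" for i
  proof (induction i rule: less_induct)
    case (less i)
    show ?case
    proof (cases "i = 1")
      case True then show ?thesis by (intro exI[of _ 0]) simp
    next
      case False
      then have "par i < i" "1 \<le> par i" "par i \<le> n" using greedy_facts(7)[of i] less.prems by auto
      then obtain k where "(par ^^ k) (par i) = 1" using less.IH by blast
      then show ?thesis by (intro exI[of _ "Suc k"]) (simp add: funpow_swap1)
    qed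
  qed
  then obtain k where "(par ^^ k) j = 1" using assms by fastforce
  then have "(LEAST k. (par ^^ k) j = 1) = Suc (LEAST m. (par ^^ Suc m) j = 1)"
    by (rule Least_Suc) (use assms in simp)
  then show ?thesis by (simp add: depth_def funpow_swap1)
qed

lemma depth_mono: "1 \<le> i \<Longrightarrow> i \<le> j \<Longrightarrow> j \<le> n \<Longrightarrow> depth i \<le> depth j"
proof (induction j arbitrary: i rule: less_induct)
  case (less j)
  show ?case
  proof (cases "i = 1")
    case False
    then have ij: "2 \<le> i" "2 \<le> j" "i \<le> n" using less by auto
    have "par i \<le> par j" using mono_onD[OF greedy_facts(4), of i j] ij less by auto
    then have "depth (par i) \<le> depth (par j)"
      using less.IH[of "par j" "par i"] greedy_facts(7)[of i] greedy_facts(7)[of j] ij less.prems by simp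
    then show ?thesis using depth_par[of i] depth_par[of j] ij less by simp
  qed simp
qed

text \<open>Extra edges join vertices of depth 1, so depth changes only along parent edges, by
  one.\<close>

lemma depth_index_edge:
  assumes "(i, j) \<in> index_edges c n par"
  shows "par j = i \<and> depth j = Suc (depth i) \<or> depth j = depth i"
proof -
  note one = parent_map_one[OF greedy_facts(3)]
  have "depth j = 1" if "2 \<le> j" "j \<le> c + 2" for j
    using depth_par[of j] one[OF that] that greedy_facts(6) by simp
  then show ?thesis using assms depth_par greedy_facts(6) by (auto simp: index_edges_def)
qed

lemma greedy_relpow_depth: "1 \<le> i \<Longrightarrow> i \<le> n \<Longrightarrow> (v i, v 1) \<in> adj G ^^ depth i"
proof (induction i rule: less_induct)
  case (less i)
  show ?case
  proof (cases "i = 1")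
    case False
    then have i: "2 \<le> i" using less by simp
    note p = greedy_facts(7)[OF i less.prems(2)]
    have "(v (par i), v 1) \<in> adj G ^^ depth (par i)" using less p by simp
    moreover have "(v i, v (par i)) \<in> adj G"
      using i less.prems by (force simp: adj_def greedy_facts(5) index_edges_def insert_commute)
    ultimately show ?thesis unfolding depth_par[OF i less.prems(2)] by (intro relpow_Suc_I2)
  qed simp
qed

lemma greedy_connected: "connected_graph G"
proof -
  have to: "(x, v 1) \<in> (adj G)\<^sup>*" if x: "x \<in> verts G" for x
  proof -
    obtain i where "1 \<le> i" "i \<le> n" "x = v i" using greedy_vertex[OF x] .
    then show ?thesis using greedy_relpow_depth[of i] relpow_imp_rtrancl by fast
  qed
  have "sym (adj G)" by (auto simp: sym_def adj_def insert_commute)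
  then have "sym ((adj G)\<^sup>*)" by (rule sym_rtrancl)
  then have "(x, y) \<in> (adj G)\<^sup>*" if "x \<in> verts G" "y \<in> verts G" for x y
    using to[OF that(1)] to[OF that(2)] by (meson rtrancl_trans symD)
  then show ?thesis using greedy_simple by (simp add: connected_graph_def)
qed

text \<open>A step changes the depth by at most one, so a walk to the root has at least
  \<open>depth i\<close> steps; following parents attains this.\<close>

lemma greedy_distance:
  assumes "1 \<le> i" "i \<le> n" shows "distance G (v i) (v 1) = depth i"
proof (rule antisym)
  show "distance G (v i) (v 1) \<le> depth i" by (rule distance_le[OF greedy_relpow_depth[OF assms]])
  have "depth i \<le> k" if "(v i, v 1) \<in> adj G ^^ k" "1 \<le> i" "i \<le> n" for i k
    using that
  proof (induction k arbitrary: i)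
    case 0
    then have "i = 1" using inj_on_eq_iff[OF greedy_facts(2), of i 1] by simp
    then show ?case by simp
  next
    case (Suc k)
    then obtain y where y: "(v i, y) \<in> adj G" "(y, v 1) \<in> adj G ^^ k" using relpow_Suc_D2 by metis
    then have "y \<in> verts G" using adj_in_verts[OF greedy_simple] by blast
    then obtain j where j: "1 \<le> j" "j \<le> n" "y = v j" by (rule greedy_vertex)
    have "depth j \<le> k" using Suc.IH[of j] y j by simp
    moreover have "(i, j) \<in> index_edges c n par \<or> (j, i) \<in> index_edges c n par"
      using y j Suc.prems index_edge_iff[OF greedy_facts(2,3), of i j] by (simp add: adj_def greedy_facts(5))
    ultimately show ?case using depth_index_edge[of i j] depth_index_edge[of j i] by auto
  qed
  moreover have "v i \<in> verts G" "v 1 \<in> verts G"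
    using assms greedy_facts(1,6) by (auto simp: bij_betw_def)
  ultimately show "depth i \<le> distance G (v i) (v 1)"
    using distance_relpow[OF greedy_connected] assms by blast
qed

lemma greedy_bfs_ordering:
  assumes "\<And>i j. 1 \<le> i \<Longrightarrow> i \<le> j \<Longrightarrow> j \<le> n \<Longrightarrow> degree G (v j) \<le> degree G (v i)"
  shows "bfs_ordering G v"
  unfolding bfs_ordering_def Let_def n_def[symmetric]
proof (intro conjI ballI impI)
  show "bij_betw v {1..n} (verts G)" by (rule greedy_facts(1))
  fix i j assume i: "i \<in> {1..n}" and j: "j \<in> {1..n}"
  show "degree G (v j) \<le> degree G (v i)" if "i \<le> j" using assms i j that by simp
  show "distance G (v i) (v 1) \<le> distance G (v j) (v 1)" if "i \<le> j"
    using greedy_distance[of i] greedy_distance[of j] depth_mono[of i j] that i j by simp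
  fix k l assume k: "k \<in> {1..n}" and l: "l \<in> {1..n}"
    and *: "v j \<in> nbhd G (v i) - nbhd G (v k) \<and> v l \<in> nbhd G (v k) - nbhd G (v i) \<and>
      distance G (v j) (v 1) = distance G (v i) (v 1) + 1 \<and>
      distance G (v l) (v 1) = distance G (v k) (v 1) + 1 \<and> i < k"
  \<comment> \<open>An edge leading one step away from the root is a parent edge, which reduces the
    exchange clause to monotonicity of \<open>par\<close>.\<close>
  have parent: "2 \<le> j \<and> par j = i" if "v j \<in> nbhd G (v i)" "i \<in> {1..n}" "j \<in> {1..n}"
    "distance G (v j) (v 1) = distance G (v i) (v 1) + 1" for i j
  proof -
    have d: "depth j = depth i + 1" using that greedy_distance[of i] greedy_distance[of j] by simp
    have "(i, j) \<in> index_edges c n par \<or> (j, i) \<in> index_edges c n par"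
      using that index_edge_iff[OF greedy_facts(2,3), of i j] by (simp add: nbhd_def greedy_facts(5))
    then have "(i, j) \<in> index_edges c n par \<and> par j = i"
      using depth_index_edge[of i j] depth_index_edge[of j i] d by auto
    then show ?thesis using index_edges_bounds[OF greedy_facts(3), of i j] by auto
  qed
  have "2 \<le> j \<and> par j = i" "2 \<le> l \<and> par l = k"
    using parent[of j i] parent[of l k] * i j k l by simp_all
  then show "j < l" using mono_onD[OF greedy_facts(4), of l j] i j k l * by (auto simp: not_le[symmetric])
qed

end

lemma B1_degree:
  assumes "distinct [a, b, e, f]" "u \<in> verts (B1 a b e f)"
  shows "degree (B1 a b e f) u \<noteq> 1"
proof
  assume "degree (B1 a b e f) u = 1"
  then obtain w where w: "nbhd (B1 a b e f) u = {w}" by (auto simp: degree_def card_1_singleton_iff)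
  consider "u = a" | "u = b" | "u = e" | "u = f" using assms(2) by (auto simp: B1_def)
  then obtain x y where "x \<noteq> y" "x \<in> nbhd (B1 a b e f) u" "y \<in> nbhd (B1 a b e f) u"
  proof cases
    case 1 show thesis by (rule that[of b e]) (use 1 assms(1) in \<open>auto simp: B1_def nbhd_def\<close>)
  next
    case 2 show thesis by (rule that[of a e]) (use 2 assms(1) in \<open>auto simp: B1_def nbhd_def\<close>)
  next
    case 3 show thesis by (rule that[of a b]) (use 3 assms(1) in \<open>auto simp: B1_def nbhd_def\<close>)
  next
    case 4 show thesis by (rule that[of a b]) (use 4 assms(1) in \<open>auto simp: B1_def nbhd_def\<close>)
  qed
  then show False using w by auto
qed

text \<open>Vertices are deleted from the last index down to the fifth; each is pendent at its turn,
  since its children are gone and extra edges end at index 4 or before.\<close>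

lemma greedy_reduced_graph:
  assumes g: "greedy 2 G v par"
  shows "is_reduced_graph G (B1 (v 1) (v 2) (v 3) (v 4))"
proof -
  define n where "n = card (verts G)"
  note facts = greedy_facts[OF g n_def]
  let ?P = "index_edges 2 n par"
  define K where "K m = (v ` {1..m}, (\<lambda>(i, j). {v i, v j}) ` {(i, j) \<in> ?P. j \<le> m})" for m
  have step: "delete_pendent (K (Suc m)) (K m)" if m: "4 \<le> m" "m < n" for m
  proof -
    let ?u = "v (Suc m)"
    have P: "{(i, j) \<in> ?P. j \<le> Suc m} = insert (par (Suc m), Suc m) {(i, j) \<in> ?P. j \<le> m}"
      using m by (auto simp: index_edges_def le_Suc_eq)
    have new: "v i \<noteq> ?u" if "1 \<le> i" "i \<le> m" for i
      using inj_on_eq_iff[OF facts(2), of "Suc m" i] that m by auto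
    have old: "v i \<noteq> ?u \<and> v j \<noteq> ?u \<and> ?u \<noteq> v i \<and> ?u \<noteq> v j" if "(i, j) \<in> ?P" "j \<le> m" for i j
      using index_edges_bounds[OF facts(3) that(1)] that new[of i] new[of j] by auto
    have par: "1 \<le> par (Suc m)" "par (Suc m) \<le> m" using facts(7)[of "Suc m"] m by auto
    have "nbhd (K (Suc m)) ?u = {v (par (Suc m))}"
    proof
      show "nbhd (K (Suc m)) ?u \<subseteq> {v (par (Suc m))}"
        using old unfolding nbhd_def K_def P by (auto simp: doubleton_eq_iff)
      show "{v (par (Suc m))} \<subseteq> nbhd (K (Suc m)) ?u"
        unfolding nbhd_def K_def P by (simp add: insert_commute)
    qed
    then have "degree (K (Suc m)) ?u = 1" by (simp add: degree_def)
    moreover have "?u \<in> verts (K (Suc m))" by (simp add: K_def)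
    moreover have "K m = delete_vertex (K (Suc m)) ?u"
    proof -
      have "verts (K (Suc m)) - {?u} = v ` {1..m}"
        using new by (auto simp: K_def atLeastAtMostSuc_conv)
      moreover have "{e \<in> edges (K (Suc m)). ?u \<notin> e} = (\<lambda>(i, j). {v i, v j}) ` {(i, j) \<in> ?P. j \<le> m}"
        using old unfolding K_def P by (auto; blast)
      ultimately show ?thesis by (simp add: delete_vertex_def K_def[of m])
    qed
    ultimately show ?thesis unfolding delete_pendent_def by blast
  qed
  have "delete_pendent\<^sup>*\<^sup>* (K n) (K m)" if "4 \<le> m" "m \<le> n" for m
    using that(2,1)
  proof (induction m rule: inc_induct)
    case (step m)
    then show ?case using \<open>4 \<le> m \<Longrightarrow> m < n \<Longrightarrow> delete_pendent (K (Suc m)) (K m)\<close>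
      by (meson le_SucI rtranclp.rtrancl_into_rtrancl)
  qed simp
  then have "delete_pendent\<^sup>*\<^sup>* (K n) (K 4)" using facts(6) by simp
  moreover have "K n = G"
  proof -
    have "{(i, j) \<in> ?P. j \<le> n} = ?P" using index_edges_bounds[OF facts(3)] by auto
    then show ?thesis using facts(1,5) by (simp add: K_def bij_betw_def prod_eq_iff)
  qed
  moreover have "K 4 = B1 (v 1) (v 2) (v 3) (v 4)"
  proof -
    have one: "par 2 = 1" "par 3 = 1" "par 4 = 1" using parent_map_one[OF facts(3)] by auto
    have i4: "{1..4} = {1, 2, 3, 4 :: nat}" "{2..4} = {2, 3, 4 :: nat}" "{3..2 + 2} = {3, 4 :: nat}" by auto
    have "{(i, j) \<in> ?P. j \<le> 4} = (\<lambda>j. (par j, j)) ` {2..4} \<union> Pair 2 ` {3..2 + 2}"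
      using facts(6) by (auto simp: index_edges_def)
    also have "\<dots> = {(1, 2), (1, 3), (1, 4), (2, 3), (2, 4)}" unfolding i4 using one by auto
    finally show ?thesis unfolding K_def B1_def i4(1) by simp
  qed
  moreover have "distinct [v 1, v 2, v 3, v 4]"
    using inj_on_eq_iff[OF facts(2)] facts(6) by simp
  ultimately show ?thesis unfolding is_reduced_graph_def using B1_degree by metis
qed

section \<open>Degree sequences of c-cyclic graphs, and existence of greedy realisations\<close>

lemma graph_class_sum_dg:
  assumes "G \<in> graph_class \<pi>"
  shows "(\<Sum>u\<in>verts G. g (degree G u)) = (\<Sum>i=1..length \<pi>. g (dg \<pi> i))"
proof -
  have "(\<Sum>u\<in>verts G. g (degree G u)) = sum_mset (image_mset g (image_mset (dg \<pi>) (mset_set {1..length \<pi>})))"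
    unfolding mset_image_dg by (rule graph_class_sum[OF assms])
  then show ?thesis by (simp add: sum_unfold_sum_mset image_mset.compositionality comp_def)
qed

lemma graph_class_length_ge_2:
  assumes "G \<in> graph_class \<pi>" "last \<pi> = 1"
  shows "2 \<le> length \<pi>"
proof (rule ccontr)
  assume *: "\<not> 2 \<le> length \<pi>"
  have "verts G \<noteq> {}" "finite (verts G)"
    using graph_class_simple[OF assms(1)] by (auto simp: simple_graph_def)
  then have "length \<pi> \<noteq> 0" using graph_class_card_verts[OF assms(1)] by auto
  then obtain x where "\<pi> = [x]" using * by (cases \<pi>) (auto simp: not_le less_Suc_eq numeral_2_eq_2)
  then have "2 * card (edges G) = 1" using graph_class_card_edges[OF assms(1)] assms(2) by simp
  then show False by presburger
qed

lemma dg_pos: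
  assumes "sorted_wrt (\<ge>) \<pi>" "last \<pi> = 1" "1 \<le> i" "i \<le> length \<pi>"
  shows "1 \<le> dg \<pi> i" "dg \<pi> (length \<pi>) = 1"
proof -
  have "\<pi> \<noteq> []" using assms(3,4) by auto
  then show *: "dg \<pi> (length \<pi>) = 1" using assms(2) by (simp add: dg_def last_conv_nth)
  show "1 \<le> dg \<pi> i" using dg_antimono[OF assms(1,3,4) order_refl] * by simp
qed

text \<open>Suppose only \<open>p \<le> c + 1\<close> vertices have degree at least 2. The others
  have degree 1, so these carry degree sum \<open>n + p + 2 * c - 2\<close>. The arc bound allows
  only \<open>p - 1 + min c (p - 2) + n - 1 + c\<close>, which is less, as
  \<open>p - 2 < c\<close>.\<close>

lemma dg_ge_2:
  assumes H: "H \<in> graph_class \<pi>" "c_cyclic c H" and \<pi>: "sorted_wrt (\<ge>) \<pi>" "last \<pi> = 1"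
    and c: "1 \<le> c" "c \<le> 2"
  shows "2 \<le> dg \<pi> (c + 2)"
proof (rule ccontr)
  assume less: "\<not> 2 \<le> dg \<pi> (c + 2)"
  define n where "n = length \<pi>"
  define A where "A = level H 2"
  define p where "p = card A"
  note sg = graph_class_simple[OF H(1)]
  have fin: "finite (verts H)" using sg by (simp add: simple_graph_def)
  have n: "card (verts H) = n" using graph_class_card_verts[OF H(1)] by (simp add: n_def)
  have nc: "c + 2 \<le> n" using c_cyclic_card_verts[OF H(2) c(2)] graph_class_length_ge_2[OF H(1) \<pi>(2)] n
    by (simp add: n_def)
  have "p = (\<Sum>i=1..n. if 2 \<le> dg \<pi> i then 1 else 0)"
    using graph_class_sum_dg[OF H(1), of "\<lambda>x. if 2 \<le> x then 1 else (0::nat)"] fin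
    by (simp add: p_def A_def level_def n_def sum.If_cases Int_def)
  also have "\<dots> = card {i \<in> {1..n}. 2 \<le> dg \<pi> i}" by (simp add: sum.If_cases Int_def)
  also have "\<dots> \<le> card {1..c + 1}"
  proof (rule card_mono)
    have "i \<le> c + 1" if "1 \<le> i" "i \<le> n" "2 \<le> dg \<pi> i" for i
      using dg_antimono[OF \<pi>(1), of "c + 2" i] less that by (fastforce simp: n_def)
    then show "{i \<in> {1..n}. 2 \<le> dg \<pi> i} \<subseteq> {1..c + 1}" by auto
  qed simp
  finally have p: "p \<le> c + 1" by simp
  have pos: "1 \<le> degree H u" if "u \<in> verts H" for u
  proof -
    have "degree H u \<in># image_mset (degree H) (mset_set (verts H))" using that fin by simp
    then have "degree H u \<in># image_mset (dg \<pi>) (mset_set {1..length \<pi>})"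
      using H(1) unfolding mset_image_dg by (simp only: graph_class_def mem_Collect_eq)
    then show ?thesis using dg_pos(1)[OF \<pi>] by auto
  qed
  have "(\<Sum>u\<in>verts H. degree H u) = (\<Sum>u\<in>A. degree H u) + (\<Sum>u\<in>verts H - A. degree H u)"
    using sum.subset_diff[of A "verts H" "degree H"] fin by (simp add: A_def level_def)
  moreover have "(\<Sum>u\<in>verts H - A. degree H u) = card (verts H - A)"
  proof -
    have "degree H u = 1" if "u \<in> verts H - A" for u
      using pos[of u] that by (auto simp: A_def level_def)
    then show ?thesis by simp
  qed
  moreover have "card (verts H - A) + p = n"
    using card_Diff_subset[of A "verts H"] card_mono[of "verts H" A] fin n
    by (auto simp: A_def level_def p_def)
  ultimately have total: "2 * (n + c) = (\<Sum>u\<in>A. degree H u) + (n - p) + 2" and "p \<le> n"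
    using handshake[OF sg] H(2) n by (auto simp: c_cyclic_def)
  show False
  proof (cases "A = {}")
    case True
    then show False using total c nc by simp
  next
    case False
    have "card (arcs_between H A (verts H)) = (\<Sum>u\<in>A. degree H u)"
      unfolding degree_def using nbhd_subset[OF sg]
      by (subst card_arcs_from[OF sg]) (auto simp: A_def level_def Int_absorb2 intro!: sum.cong arg_cong[of _ _ card])
    moreover have "card (arcs_between H A (verts H)) \<le> edge_bound c p + edge_bound c n"
      using card_arcs_between_le_edge_bound[OF H(2) c(2), of A "verts H"] False n
      by (simp add: A_def level_def p_def)
    moreover have "p \<noteq> 0" using False fin by (simp add: p_def A_def level_def)
    ultimately show False using total p nc \<open>p \<le> n\<close> c by (auto simp: edge_bound_def)
  qed
qed

text \<open>For \<open>c = 2\<close> the second vertex needs its parent and two extra edges, hence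
  the assumption \<open>d2\<close>; sequences violating it are realised by two triangles with
  paths.\<close>

lemma cyclic_sequence_dg:
  assumes H: "H \<in> graph_class \<pi>" "c_cyclic c H" and \<pi>: "sorted_wrt (\<ge>) \<pi>" "last \<pi> = 1"
    and c: "c \<le> 2" and d2: "c = 2 \<Longrightarrow> 3 \<le> dg \<pi> 2"
  shows "cyclic_sequence c (length \<pi>) (dg \<pi>)"
proof
  note sg = graph_class_simple[OF H(1)]
  have n: "card (verts H) = length \<pi>" by (rule graph_class_card_verts[OF H(1)])
  show nc: "c + 2 \<le> length \<pi>"
    using c_cyclic_card_verts[OF H(2) c] graph_class_length_ge_2[OF H(1) \<pi>(2)] n by simp
  show "dg \<pi> j \<le> dg \<pi> i" if "1 \<le> i" "i \<le> j" "j \<le> length \<pi>" for i j by (rule dg_antimono[OF \<pi>(1) that])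
  show "dg \<pi> (length \<pi>) = 1" using dg_pos(2)[OF \<pi>, of 1] nc by simp
  show "(\<Sum>k=1..length \<pi>. dg \<pi> k) + 2 = 2 * (length \<pi> + c)"
    using graph_class_sum_dg[OF H(1), of "\<lambda>x. x"] handshake[OF sg] H(2) n by (simp add: c_cyclic_def)
  fix i assume i: "2 \<le> i" "i \<le> length \<pi>"
  have pos: "1 \<le> dg \<pi> i" using dg_pos(1)[OF \<pi>] i by simp
  have two: "2 \<le> dg \<pi> i" if "1 \<le> c" "i \<le> c + 2"
    using dg_ge_2[OF H \<pi> that(1) c] dg_antimono[OF \<pi>(1), of i "c + 2"] that i nc by simp
  have "c = 0 \<or> c = 1 \<or> c = 2" using c by linarith
  then show "1 + extra_degree c i \<le> dg \<pi> i"
    using pos two d2 by (auto simp: extra_degree_def)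
qed

lemma (in cyclic_sequence) exists_greedy_graph:
  assumes "finite V" "card V = n"
  shows "\<exists>G v. verts G = V \<and> greedy c G v (bfs_parent c d) \<and> (\<forall>i\<in>{1..n}. degree G (v i) = d i)"
proof -
  obtain v where v: "bij_betw v {1..n} V" using ex_bij_betw_nat_finite_1[OF assms(1)] assms(2) by auto
  define G where "G = (V, (\<lambda>(i, j). {v i, v j}) ` index_edges c n par)"
  have nG: "n = card (verts G)" using assms by (simp add: G_def)
  have g: "greedy c G v par"
    unfolding greedy_def nG[symmetric]
    using v parent_map_bfs_parent mono_bfs_parent by (simp add: G_def)
  have "degree G (v i) = d i" if "i \<in> {1..n}" for i
    using greedy_degree[OF g nG, of i] bfs_children(2)[of i] enough[of i] that
    by (auto simp: children_def extra_degree_def split: if_splits)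
  then show ?thesis using g by (intro exI[of _ G] exI[of _ v]) (simp add: G_def)
qed

lemma exists_greedy_in_class:
  fixes H :: "'a ugraph"
  assumes H: "H \<in> graph_class \<pi>" "c_cyclic c H" and \<pi>: "sorted_wrt (\<ge>) \<pi>" "last \<pi> = 1"
    and c: "c \<le> 2" and d2: "c = 2 \<Longrightarrow> 3 \<le> dg \<pi> 2"
  obtains G :: "'a ugraph" and v where "greedy c G v (bfs_parent c (dg \<pi>))" "G \<in> graph_class \<pi>" "c_cyclic c G"
    "bij_betw v {1..length \<pi>} (verts G)" "\<And>i. i \<in> {1..length \<pi>} \<Longrightarrow> degree G (v i) = dg \<pi> i" "bfs_ordering G v"
proof -
  interpret cyclic_sequence c "length \<pi>" "dg \<pi>" by (rule cyclic_sequence_dg[OF assms])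
  have fin: "finite (verts H)" using graph_class_simple[OF H(1)] by (simp add: simple_graph_def)
  obtain G v where G: "verts G = verts H" "greedy c G v par" "\<And>i. i \<in> {1..length \<pi>} \<Longrightarrow> degree G (v i) = dg \<pi> i"
    \<comment> \<open>The vertex set of \<open>H\<close> is reused, since the type \<open>'a\<close>
      need not contain other vertices.\<close>
    using exists_greedy_graph[OF fin graph_class_card_verts[OF H(1)]] by blast
  have n: "length \<pi> = card (verts G)" using G(1) graph_class_card_verts[OF H(1)] by simp
  have bij: "bij_betw v {1..length \<pi>} (verts G)" by (rule greedy_facts(1)[OF G(2) n])
  have cl: "G \<in> graph_class \<pi>" by (rule graph_class_of_ordering[OF greedy_connected[OF G(2) n] bij G(3)])
  have "bfs_ordering G v"
    by (rule greedy_bfs_ordering[OF G(2) n]) (use G(3) dec in auto)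
  then show thesis using that[OF G(2) cl graph_class_c_cyclic[OF H(1) cl H(2)] bij G(3)] by blast
qed

lemma exists_U_M:
  fixes H :: "'a ugraph"
  assumes H: "H \<in> graph_class \<pi>" "c_cyclic 1 H" and \<pi>: "sorted_wrt (\<ge>) \<pi>" "last \<pi> = 1"
  shows "\<exists>G :: 'a ugraph. is_U_M \<pi> G"
proof -
  define d where "d = dg \<pi>"
  define n where "n = length \<pi>"
  interpret cyclic_sequence 1 n d unfolding n_def d_def by (rule cyclic_sequence_dg[OF assms]) auto
  obtain G :: "'a ugraph" and v where G: "greedy 1 G v par" "G \<in> graph_class \<pi>" "c_cyclic 1 G"
    "bij_betw v {1..n} (verts G)" "\<And>i. i \<in> {1..n} \<Longrightarrow> degree G (v i) = d i"
    unfolding n_def d_def by (rule exists_greedy_in_class[OF assms]) auto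
  have nG: "n = card (verts G)" using graph_class_card_verts[OF G(2)] by (simp add: n_def)
  note nb = greedy_nbhd[OF G(1) nG] and one = parent_map_one[OF parent_map_bfs_parent]
  have d2: "2 \<le> d 2" "2 \<le> d 3" using enough[of 2] enough[of 3] n by (auto simp: extra_degree_def)
  have s1: "s 1 = d 1 + 1" using last_child_Suc[of 1 d 0] by (simp add: children_def)
  have s2: "s 2 = d 1 + d 2 - 1"
    using last_child_Suc[of 1 d 1] s1 d2 by (simp add: children_def extra_degree_def numeral_2_eq_2)
  have s3: "s 3 = d 1 + d 2 + d 3 - 3"
    using last_child_Suc[of 1 d 2] s2 d2 by (simp add: children_def extra_degree_def eval_nat_numeral)
  \<comment> \<open>From the fourth vertex on only the parent edge is lost, so the difference of
    \<open>s\<close> and the partial degree sum grows by one per vertex.\<close>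
  have si: "s i + i = (\<Sum>k=1..i. d k)" if "3 \<le> i" "i \<le> n" for i
    using that
  proof (induction i rule: dec_induct)
    case base
    have "(\<Sum>k=1..3. d k) = d 1 + d 2 + d 3" by (simp add: eval_nat_numeral)
    then show ?case using s3 d2 by simp
  next
    case (step i)
    then have "children 1 d (Suc i) + 1 = d (Suc i)"
      using enough[of "Suc i"] by (simp add: children_def extra_degree_def)
    then show ?case using step by (simp add: last_child_Suc)
  qed
  have e3: "{3..1 + 2} = {3 :: nat}" by auto
  have N1: "nbhd G (v 1) = v ` {2..d 1 + 1}"
    using nb[of 1] bfs_children(1)[of 1] s1 n by (simp add: index_nbhd_def numeral_2_eq_2)
  have N2: "nbhd G (v 2) = v ` ({1, 3} \<union> {d 1 + 2..d 1 + d 2 - 1})"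
  proof -
    have "index_nbhd 1 n par 2 = {1, 3} \<union> {s 1 + 1..s 2}"
      using bfs_children(1)[of 2] n one[of 2] unfolding index_nbhd_def e3 by auto
    then show ?thesis using nb[of 2] n s1 s2 by simp
  qed
  have N3: "nbhd G (v 3) = v ` ({1, 2} \<union> {d 1 + d 2..d 1 + d 2 + d 3 - 3})"
  proof -
    have "index_nbhd 1 n par 3 = {1, 2} \<union> {s 2 + 1..s 3}"
      using bfs_children(1)[of 3] n one[of 3] unfolding index_nbhd_def by auto
    then show ?thesis using nb[of 3] n s2 s3 d2 by simp
  qed
  have N4: "\<exists>p\<in>{1..<i}. nbhd G (v i) = v ` ({p} \<union> {(\<Sum>k=1..i-1. d k) - (i - 2)..(\<Sum>k=1..i. d k) - i})"
    if i: "i \<in> {4..n}" for i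
  proof
    have "3 \<le> i - 1" "i - 1 \<le> n" "3 \<le> i" "i \<le> n" using i by auto
    note S = si[OF this(1,2)] si[OF this(3,4)]
    show "par i \<in> {1..<i}" using bfs_parent_bounds[of i] that by simp
    have "index_nbhd 1 n par i = {par i} \<union> {s (i - 1) + 1..s i}"
      using bfs_children(1)[of i] that by (auto simp: index_nbhd_def)
    moreover have "s (i - 1) + 1 = (\<Sum>k=1..i-1. d k) - (i - 2)" "s i = (\<Sum>k=1..i. d k) - i"
      using S i by (simp_all only: S[symmetric]) auto
    ultimately show "nbhd G (v i) = v ` ({par i} \<union> {(\<Sum>k=1..i-1. d k) - (i - 2)..(\<Sum>k=1..i. d k) - i})"
      using nb[of i] that by simp
  qed
  have "is_U_M \<pi> G" unfolding is_U_M_def n_def[symmetric] d_def[symmetric]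
    by (intro conjI exI[of _ v] ballI G(3-5) N1 N2 N3 N4)
  then show ?thesis by blast
qed

section \<open>Paths attached to two triangles\<close>

lemma list_partition_lengths:
  "sum_list ls = length xs \<Longrightarrow> \<exists>ps. concat ps = xs \<and> map length ps = ls"
proof (induction ls arbitrary: xs)
  case Nil
  then show ?case by (intro exI[of _ "[]"]) simp
next
  case (Cons l ls)
  then have "sum_list ls = length (drop l xs)" by simp
  then obtain ps where "concat ps = drop l xs" "map length ps = ls" using Cons.IH by blast
  then show ?case using Cons.prems by (intro exI[of _ "take l xs # ps"]) simp
qed

lemma list_balanced_partition:
  assumes "1 \<le> k" "k \<le> length xs"
  obtains ps where "concat ps = xs" "length ps = k" "\<And>p. p \<in> set ps \<Longrightarrow> p \<noteq> []"
    "\<And>p q. p \<in> set ps \<Longrightarrow> q \<in> set ps \<Longrightarrow> length p \<le> length q + 1"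
proof -
  define m where "m = length xs div k"
  define t where "t = length xs mod k"
  have t: "t < k" and m: "1 \<le> m" using assms by (auto simp: t_def m_def div_greater_zero_iff Suc_le_eq)
  have "t * (m + 1) + (k - t) * m = t + k * m"
  proof -
    have "(k - t) * m + t * m = k * m" using t by (simp add: add_mult_distrib[symmetric])
    then show ?thesis by (simp add: algebra_simps)
  qed
  then have "sum_list (replicate t (m + 1) @ replicate (k - t) m) = length xs"
    by (simp add: sum_list_replicate m_def t_def)
  from list_partition_lengths[OF this] obtain ps where
    ps: "concat ps = xs" "map length ps = replicate t (m + 1) @ replicate (k - t) m" by blast
  have len: "length p = m \<or> length p = m + 1" if "p \<in> set ps" for p
  proof -
    have "length p \<in> set (replicate t (m + 1) @ replicate (k - t) m)"
      unfolding ps(2)[symmetric] using that by simp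
    then show ?thesis by (auto split: if_splits)
  qed
  show thesis
  proof (rule that[OF ps(1)])
    show "length ps = k" using arg_cong[OF ps(2), of length] t by simp
    show "p \<noteq> []" if "p \<in> set ps" for p using len[OF that] m by auto
    show "length p \<le> length q + 1" if "p \<in> set ps" "q \<in> set ps" for p q
      using len[OF that(1)] len[OF that(2)] by auto
  qed
qed

text \<open>Size and sum are two independent linear equations for the multiplicities of 1 and
  2.\<close>

lemma mset_of_ones_and_twos_eqI:
  fixes M N :: "nat multiset"
  assumes "set_mset M \<subseteq> {1, 2}" "set_mset N \<subseteq> {1, 2}" "size M = size N" "sum_mset M = sum_mset N"
  shows "M = N"
proof -
  have sz: "size K = count K 1 + count K 2 \<and> sum_mset K = count K 1 + 2 * count K 2"
    if "set_mset K \<subseteq> {1, 2}" for K :: "nat multiset"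
    using that by (induction K) auto
  have "count M x = count N x" for x
  proof (cases "x \<in> {1, 2}")
    case True
    then show ?thesis using sz[OF assms(1)] sz[OF assms(2)] assms(3,4) by auto
  next
    case False
    then have "x \<notin># M" "x \<notin># N" using assms by auto
    then show ?thesis by (simp add: not_in_iff)
  qed
  then show ?thesis by (rule multiset_eqI)
qed

section \<open>Structure and degrees of two triangles with attached paths\<close>

locale paths_at_bowtie =
  fixes r v2 v3 v4 v5 :: 'a and ps :: "'a list list"
  assumes dist: "distinct ([r, v2, v3, v4, v5] @ concat ps)" and nonempty: "\<And>p. p \<in> set ps \<Longrightarrow> p \<noteq> []"
begin

definition "G = attach_paths (B2 r v2 v3 v4 v5) r ps"
definition "leaves = last ` set ps"
definition "bowtie_edges = {{r, v2}, {r, v3}, {v2, v3}, {r, v4}, {r, v5}, {v4, v5}}"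

lemma verts_G: "verts G = {r, v2, v3, v4, v5} \<union> set (concat ps)"
  by (simp add: G_def attach_paths_def B2_def)

text \<open>Indexing a path edge by its outer end \<open>q ! j\<close> makes
  \<open>(r # q) ! j\<close> the inner end, so the edge at \<open>r\<close> needs no separate
  treatment.\<close>

lemma edges_G: "edges G = bowtie_edges \<union>
    {{(r # q) ! j, q ! j} | q j. q \<in> set ps \<and> j < length q}"
proof -
  have "(\<Union>p\<in>set ps. path_edges (r # p)) = {{(r # q) ! j, q ! j} | q j. q \<in> set ps \<and> j < length q}"
    by (auto simp: path_edges_def)
  then show ?thesis by (simp add: G_def attach_paths_def B2_def bowtie_edges_def)
qed

lemma edgeE:
  assumes "e \<in> edges G"
  obtains "e \<in> bowtie_edges" | q j where "q \<in> set ps" "j < length q" "e = {(r # q) ! j, q ! j}"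
  using assms unfolding edges_G by blast

lemma path_edge: "q \<in> set ps \<Longrightarrow> j < length q \<Longrightarrow> {(r # q) ! j, q ! j} \<in> edges G"
  unfolding edges_G by blast

lemma path_edge_Suc: "q \<in> set ps \<Longrightarrow> Suc j < length q \<Longrightarrow> {q ! j, q ! Suc j} \<in> edges G"
  using path_edge[of q "Suc j"] by simp

lemma bowtie_edge: "e \<in> bowtie_edges \<Longrightarrow> e \<in> edges G"
  by (simp add: edges_G)

lemma bowtie_distinct: "distinct [r, v2, v3, v4, v5]"
  using dist by simp

lemma path_vertex_not_bowtie:
  "q \<in> set ps \<Longrightarrow> j < length q \<Longrightarrow> q ! j \<notin> {r, v2, v3, v4, v5}"
  using dist nth_mem[of j q] by auto

lemma path_vertex_in_verts:
  assumes "q \<in> set ps" "j < length q" shows "q ! j \<in> verts G"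
  using assms(1) nth_mem[OF assms(2)] unfolding verts_G set_concat by blast

lemma path_vertex_unique:
  assumes "p \<in> set ps" "q \<in> set ps" "i < length p" "j < length q" "p ! i = q ! j"
  shows "p = q \<and> i = j"
proof -
  have d: "distinct (concat ps)" using dist by simp
  have "p = q"
  proof (rule ccontr)
    assume "p \<noteq> q"
    then have "set p \<inter> set q = {}" using d assms(1,2) by (auto simp: distinct_concat_iff)
    then show False using nth_mem[OF assms(3)] nth_mem[OF assms(4)] assms(5) by auto
  qed
  moreover have "distinct p" using d assms(1) by (auto simp: distinct_concat_iff)
  ultimately show ?thesis using assms nth_eq_iff_index_eq by blast
qed

lemma path_vertexE:
  assumes "x \<in> set (concat ps)" obtains p i where "p \<in> set ps" "i < length p" "x = p ! i"
  using assms by (auto simp: in_set_conv_nth)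

lemma path_edge_distinct:
  assumes "q \<in> set ps" "j < length q" shows "(r # q) ! j \<noteq> q ! j"
proof (cases j)
  case 0
  then show ?thesis using path_vertex_not_bowtie[OF assms] by auto
next
  case (Suc k)
  then show ?thesis using path_vertex_unique[OF assms(1,1), of k j] assms by auto
qed

lemma pred_in_verts:
  assumes "q \<in> set ps" "j < length q" shows "(r # q) ! j \<in> verts G"
proof (cases j)
  case (Suc k)
  then have "q ! k \<in> set q" using assms by simp
  then show ?thesis using Suc assms(1) by (auto simp: verts_G)
qed (simp add: verts_G)

lemma simple_G: "simple_graph G"
  unfolding simple_graph_def
proof (intro conjI ballI)
  show "finite (verts G)" "verts G \<noteq> {}" by (auto simp: verts_G)
  fix e assume "e \<in> edges G"
  then have "e \<subseteq> verts G \<and> card e = 2"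
  proof (cases rule: edgeE)
    case 1
    then show ?thesis using bowtie_distinct by (auto simp: verts_G bowtie_edges_def)
  next
    case 2
    then show ?thesis using pred_in_verts[OF 2(1,2)] path_edge_distinct[OF 2(1,2)] path_vertex_in_verts[OF 2(1,2)]
      by simp
  qed
  then show "e \<subseteq> verts G" "card e = 2" by auto
qed

lemma connected_G: "connected_graph G"
proof -
  have path: "(r, q ! j) \<in> (adj G)\<^sup>*" if "q \<in> set ps" "j < length q" for q j
    using that(2)
  proof (induction j)
    case 0
    then show ?case using path_edge[OF that(1), of 0] by (auto simp: adj_def)
  next
    case (Suc j)
    then have "(q ! j, q ! Suc j) \<in> adj G" using path_edge_Suc[OF that(1)] by (simp add: adj_def)
    then show ?case using Suc by (meson Suc_lessD rtrancl.rtrancl_into_rtrancl)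
  qed
  have from_r: "(r, x) \<in> (adj G)\<^sup>*" if "x \<in> verts G" for x
  proof (cases "x \<in> set (concat ps)")
    case True
    then obtain p i where "p \<in> set ps" "i < length p" "x = p ! i" by (rule path_vertexE)
    then show ?thesis using path by simp
  next
    case False
    then have "x = r \<or> (r, x) \<in> adj G" using that by (auto simp: verts_G adj_def edges_G bowtie_edges_def)
    then show ?thesis by auto
  qed
  have "sym (adj G)" by (auto simp: sym_def adj_def insert_commute)
  then have "sym ((adj G)\<^sup>*)" by (rule sym_rtrancl)
  then have "(x, y) \<in> (adj G)\<^sup>*" if "x \<in> verts G" "y \<in> verts G" for x y
    using from_r[OF that(1)] from_r[OF that(2)] by (meson rtrancl_trans symD)
  then show ?thesis using simple_G by (simp add: connected_graph_def)
qed

lemma nbhd_path_vertex: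
  assumes "p \<in> set ps" "i < length p"
  shows "nbhd G (p ! i) = {(r # p) ! i} \<union> (if Suc i < length p then {p ! Suc i} else {})"
proof
  show "nbhd G (p ! i) \<subseteq> {(r # p) ! i} \<union> (if Suc i < length p then {p ! Suc i} else {})"
  proof
    fix w assume "w \<in> nbhd G (p ! i)"
    then have "{p ! i, w} \<in> edges G" by (simp add: nbhd_def)
    moreover have "{p ! i, w} \<notin> bowtie_edges"
      using path_vertex_not_bowtie[OF assms] by (auto simp: bowtie_edges_def doubleton_eq_iff)
    ultimately obtain q j where q: "q \<in> set ps" "j < length q" "{p ! i, w} = {(r # q) ! j, q ! j}"
      using edgeE by metis
    then consider "p ! i = q ! j" "w = (r # q) ! j" | "p ! i = (r # q) ! j" "w = q ! j"
      by (auto simp: doubleton_eq_iff)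
    then show "w \<in> {(r # p) ! i} \<union> (if Suc i < length p then {p ! Suc i} else {})"
    proof cases
      case 1
      then show ?thesis using path_vertex_unique[OF assms(1) q(1) assms(2) q(2)] by auto
    next
      case 2
      show ?thesis
      proof (cases j)
        case 0
        then show ?thesis using 2 path_vertex_not_bowtie[OF assms] by auto
      next
        case (Suc k)
        then have "p = q \<and> i = k" using path_vertex_unique[OF assms(1) q(1) assms(2), of k] 2 q by auto
        then show ?thesis using 2 Suc q by auto
      qed
    qed
  qed
  note path_edge[OF assms] path_edge_Suc[OF assms(1), of i]
  then show "{(r # p) ! i} \<union> (if Suc i < length p then {p ! Suc i} else {}) \<subseteq> nbhd G (p ! i)"
    by (auto simp: nbhd_def insert_commute)
qed

lemma degree_path_vertex:
  assumes "p \<in> set ps" "i < length p"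
  shows "degree G (p ! i) = (if Suc i < length p then 2 else 1)"
proof (cases "Suc i < length p")
  case True
  have "(r # p) ! i \<noteq> p ! Suc i"
  proof (cases i)
    case 0
    then show ?thesis using path_vertex_not_bowtie[OF assms(1) True] by auto
  next
    case (Suc k)
    then show ?thesis using path_vertex_unique[OF assms(1,1), of k "Suc i"] True by auto
  qed
  then show ?thesis using True by (simp add: degree_def nbhd_path_vertex[OF assms])
qed (simp add: degree_def nbhd_path_vertex[OF assms])

lemma path_edge_bowtie:
  assumes "q \<in> set ps" "j < length q" "{x, w} = {(r # q) ! j, q ! j}" "x \<in> {r, v2, v3, v4, v5}"
  shows "x = r \<and> j = 0 \<and> w = q ! 0"
proof -
  have "x \<noteq> q ! j" using path_vertex_not_bowtie[OF assms(1,2)] assms(4) by auto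
  then have x: "x = (r # q) ! j" "w = q ! j" using assms(3) by (auto simp: doubleton_eq_iff)
  have "j = 0"
  proof (rule ccontr)
    assume "j \<noteq> 0"
    then obtain k where "j = Suc k" using not0_implies_Suc by blast
    then show False using path_vertex_not_bowtie[OF assms(1), of k] assms(2,4) x by auto
  qed
  then show ?thesis using x by simp
qed

lemma nbhd_bowtie:
  assumes "x \<in> {r, v2, v3, v4, v5}"
  shows "nbhd G x = {w. {x, w} \<in> bowtie_edges} \<union>
    (if x = r then (\<lambda>q. q ! 0) ` set ps else {})"
proof
  show "nbhd G x \<subseteq> {w. {x, w} \<in> bowtie_edges} \<union>
    (if x = r then (\<lambda>q. q ! 0) ` set ps else {})"
  proof
    fix w assume "w \<in> nbhd G x"
    then have "{x, w} \<in> edges G" by (simp add: nbhd_def)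
    then show "w \<in> {w. {x, w} \<in> bowtie_edges} \<union>
      (if x = r then (\<lambda>q. q ! 0) ` set ps else {})"
    proof (cases rule: edgeE)
      case (2 q j)
      then show ?thesis using path_edge_bowtie[OF 2 assms] by auto
    qed blast
  qed
  have "{r, q ! 0} \<in> edges G" if "q \<in> set ps" for q
    using path_edge[OF that, of 0] nonempty[OF that] by simp
  then show "{w. {x, w} \<in> bowtie_edges} \<union>
    (if x = r then (\<lambda>q. q ! 0) ` set ps else {}) \<subseteq> nbhd G x"
    using bowtie_edge by (auto simp: nbhd_def split: if_splits)
qed

lemma nbhd_r: "nbhd G r = {v2, v3, v4, v5} \<union> (\<lambda>q. q ! 0) ` set ps"
proof -
  have "{w. {r, w} \<in> bowtie_edges} = {v2, v3, v4, v5}"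
    using bowtie_distinct by (auto simp: bowtie_edges_def doubleton_eq_iff)
  then show ?thesis using nbhd_bowtie[of r] by simp
qed

text \<open>Disjointness of the paths separates only nonempty lists: the empty list could be
  repeated without disturbing \<open>concat ps\<close>.\<close>

lemma card_set_ps: "card (set ps) = length ps"
proof -
  have "[] \<notin> set ps" using nonempty by blast
  moreover have "distinct (removeAll [] ps)" using dist by (simp add: distinct_concat_iff)
  ultimately show ?thesis by (simp add: distinct_card)
qed

lemma degree_r: "degree G r = length ps + 4"
proof -
  have "inj_on (\<lambda>q. q ! 0) (set ps)"
  proof (rule inj_onI)
    fix p q assume "p \<in> set ps" "q \<in> set ps" "p ! 0 = q ! 0"
    then show "p = q" using path_vertex_unique[of p q 0 0] nonempty by simp
  qed
  then have "card ((\<lambda>q. q ! 0) ` set ps) = length ps" by (simp add: card_image card_set_ps)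
  moreover have "{v2, v3, v4, v5} \<inter> (\<lambda>q. q ! 0) ` set ps = {}"
  proof -
    have "q ! 0 \<notin> {v2, v3, v4, v5}" if "q \<in> set ps" for q
      using path_vertex_not_bowtie[OF that, of 0] nonempty[OF that] by simp
    then show ?thesis by blast
  qed
  moreover have "card {v2, v3, v4, v5} = 4" using bowtie_distinct by simp
  ultimately show ?thesis unfolding degree_def nbhd_r by (subst card_Un_disjoint) simp_all
qed

lemma degree_bowtie: "x \<in> {v2, v3, v4, v5} \<Longrightarrow> degree G x = 2"
proof -
  assume x: "x \<in> {v2, v3, v4, v5}"
  then have "nbhd G x = {w. {x, w} \<in> bowtie_edges}"
    using nbhd_bowtie[of x] bowtie_distinct by auto
  also have "\<dots> = {r, if x = v2 then v3 else if x = v3 then v2 else if x = v4 then v5 else v4}"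
    using x bowtie_distinct by (auto simp: bowtie_edges_def doubleton_eq_iff)
  finally show ?thesis using x bowtie_distinct by (auto simp: degree_def)
qed

lemma leaves_subset: "leaves \<subseteq> verts G - {r, v2, v3, v4, v5}"
proof
  fix x assume "x \<in> leaves"
  then obtain p where p: "p \<in> set ps" "x = last p" by (auto simp: leaves_def)
  then have "x = p ! (length p - 1)" "length p - 1 < length p"
    using nonempty by (auto simp: last_conv_nth)
  then show "x \<in> verts G - {r, v2, v3, v4, v5}"
    using path_vertex_not_bowtie[OF p(1)] path_vertex_in_verts[OF p(1)] by simp
qed

lemma degree_not_r:
  assumes "x \<in> verts G" "x \<noteq> r"
  shows "degree G x = (if x \<in> leaves then 1 else 2)"
proof (cases "x \<in> set (concat ps)")
  case True
  then obtain p i where p: "p \<in> set ps" "i < length p" "x = p ! i" by (rule path_vertexE)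
  have "x \<in> leaves \<longleftrightarrow> \<not> Suc i < length p"
  proof
    assume "x \<in> leaves"
    then obtain q where q: "q \<in> set ps" "x = last q" by (auto simp: leaves_def)
    then have "x = q ! (length q - 1)" "length q - 1 < length q"
      using nonempty by (auto simp: last_conv_nth)
    then have "p = q \<and> i = length q - 1" using path_vertex_unique[OF p(1) q(1) p(2), of "length q - 1"] p(3) by simp
    then show "\<not> Suc i < length p" using p by auto
  next
    assume "\<not> Suc i < length p"
    then have "i = length p - 1" using p by simp
    then have "x = last p" using p nonempty by (simp add: last_conv_nth)
    then show "x \<in> leaves" using p by (simp add: leaves_def)
  qed
  then show ?thesis using degree_path_vertex[OF p(1,2)] p(3) by simp
next
  case False
  then have "x \<in> {v2, v3, v4, v5}" using assms by (auto simp: verts_G)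
  then show ?thesis using degree_bowtie leaves_subset by auto
qed

lemma card_leaves: "card leaves = length ps"
proof -
  have "inj_on last (set ps)"
  proof (rule inj_onI)
    fix p q assume "p \<in> set ps" "q \<in> set ps" "last p = last q"
    then show "p = q"
      using path_vertex_unique[of p q "length p - 1" "length q - 1"] nonempty
      by (auto simp: last_conv_nth)
  qed
  then show ?thesis by (simp add: leaves_def card_image card_set_ps)
qed

section \<open>Class membership and extremality of two triangles with balanced paths\<close>

context
  fixes \<pi> :: "nat list" and n :: nat
  assumes n: "n = length \<pi>" "card (verts G) = n" and dec: "sorted_wrt (\<ge>) \<pi>"
    and pos: "\<And>x. x \<in> set \<pi> \<Longrightarrow> 1 \<le> x"
    and d1: "5 \<le> dg \<pi> 1" and d2: "dg \<pi> 2 = 2" and k: "length ps = dg \<pi> 1 - 4"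
    and total: "sum_list \<pi> = 2 * (n + 1)"
begin

lemma finite_verts: "finite (verts G)"
  using simple_G by (simp add: simple_graph_def)

lemma r_in_verts: "r \<in> verts G"
  by (simp add: verts_G)

lemma degree_root: "degree G r = dg \<pi> 1"
  using degree_r k d1 by simp

text \<open>Away from the root, the degrees of \<open>G\<close> and the remaining entries of
  \<open>\<pi>\<close> are all 1 or 2. They agree in number and sum, hence as multisets.\<close>

lemma G_in_class: "G \<in> graph_class \<pi>"
proof -
  let ?W = "verts G - {r}"
  have "\<pi> \<noteq> []" using n r_in_verts finite_verts by (auto simp: card_eq_0_iff)
  then obtain ds where ds: "\<pi> = dg \<pi> 1 # ds" by (cases \<pi>) (auto simp: dg_def)
  have W: "finite ?W" "card ?W = n - 1" "1 \<le> n" "leaves \<subseteq> ?W"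
    using finite_verts r_in_verts n leaves_subset by (auto simp: card_gt_0_iff Suc_le_eq)
  have "image_mset (degree G) (mset_set ?W) = mset ds"
  proof (rule mset_of_ones_and_twos_eqI)
    show "set_mset (image_mset (degree G) (mset_set ?W)) \<subseteq> {1, 2}"
      using degree_not_r W by auto
    show "set_mset (mset ds) \<subseteq> {1, 2}"
    proof
      fix x assume "x \<in># mset ds"
      then have x: "x \<in> set ds" by simp
      then obtain i where i: "i < length ds" "x = ds ! i" by (auto simp: in_set_conv_nth)
      have len: "length \<pi> = Suc (length ds)" using arg_cong[OF ds, of length] by simp
      have "dg \<pi> (i + 2) = x" using i arg_cong[OF ds, of "\<lambda>l. l ! Suc i"] by (simp add: dg_def)
      then have "x \<le> 2" using dg_antimono[OF dec, of 2 "i + 2"] d2 i len by simp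
      moreover have "1 \<le> x" using pos[of x] x arg_cong[OF ds, of set] by auto
      ultimately show "x \<in> {1, 2}" by auto
    qed
    have len: "length ds = n - 1" using arg_cong[OF ds, of length] n by simp
    then show "size (image_mset (degree G) (mset_set ?W)) = size (mset ds)" using W by simp
    have "sum_mset (image_mset (degree G) (mset_set ?W)) = (\<Sum>x\<in>?W. degree G x)"
      by (simp add: sum_unfold_sum_mset)
    also have "\<dots> = (\<Sum>x\<in>?W. if x \<in> leaves then 1 else 2)"
      by (rule sum.cong) (use degree_not_r in auto)
    also have "\<dots> = card leaves + 2 * card (?W - leaves)"
    proof -
      have "?W \<inter> {x. x \<in> leaves} = leaves" "?W \<inter> - {x. x \<in> leaves} = ?W - leaves" using W by auto
      then show ?thesis using W by (simp only: sum.If_cases[OF W(1)]) simp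
    qed
    also have "card (?W - leaves) = n - 1 - card leaves"
      using W finite_subset[OF W(4) W(1)] by (simp add: card_Diff_subset)
    finally have S: "sum_mset (image_mset (degree G) (mset_set ?W)) = card leaves + 2 * (n - 1 - card leaves)" .
    have "card leaves \<le> n - 1" using card_mono[OF W(1) W(4)] W(2) by simp
    moreover have "sum_list ds + dg \<pi> 1 = 2 * (n + 1)" using total arg_cong[OF ds, of sum_list] by simp
    ultimately show "sum_mset (image_mset (degree G) (mset_set ?W)) = sum_mset (mset ds)"
      using S card_leaves k d1 W(3) by (simp add: sum_mset_sum_list)
  qed
  moreover have "mset_set (verts G) = add_mset r (mset_set ?W)"
    using mset_set.remove[OF finite_verts r_in_verts] .
  ultimately have "image_mset (degree G) (mset_set (verts G)) = mset (dg \<pi> 1 # ds)"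
    using degree_root by simp
  then show ?thesis unfolding ds[symmetric] using connected_G by (simp add: graph_class_def)
qed

lemma G_bicyclic: "c_cyclic 2 G"
  using graph_class_card_edges[OF G_in_class] total n connected_G by (simp add: c_cyclic_def)

lemma levels:
  "a \<le> 1 \<Longrightarrow> level G a = verts G" "level G 2 = verts G - leaves"
  "3 \<le> a \<Longrightarrow> level G a \<subseteq> {r}" "3 \<le> a \<Longrightarrow> a \<le> dg \<pi> 1 \<Longrightarrow> level G a = {r}"
proof -
  have deg: "degree G x = (if x = r then dg \<pi> 1 else if x \<in> leaves then 1 else 2)" if "x \<in> verts G" for x
    using degree_not_r[OF that] degree_root by auto
  show "a \<le> 1 \<Longrightarrow> level G a = verts G" "3 \<le> a \<Longrightarrow> level G a \<subseteq> {r}"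
    "3 \<le> a \<Longrightarrow> a \<le> dg \<pi> 1 \<Longrightarrow> level G a = {r}"
    using deg d1 r_in_verts by (auto simp: level_def split: if_splits)
  show "level G 2 = verts G - leaves"
    using deg d1 leaves_subset by (auto simp: level_def)
qed

text \<open>Each leaf lies on one edge, so dropping the leaves loses at most two arcs per leaf out
  of \<open>2 * (n + 1)\<close>. At least \<open>2 * (card A + 1)\<close> remain, which is twice the
  edge bound.\<close>

lemma inner_arcs:
  assumes A: "A = verts G - leaves"
  shows "edge_bound 2 (card A) + edge_bound 2 (card A) \<le> card (arcs_between G A A)"
proof -
  have finL: "finite leaves" by (simp add: leaves_def)
  have L: "leaves \<subseteq> verts G" using leaves_subset by auto
  have "card {r, v2, v3, v4, v5} \<le> card A"
    by (rule card_mono) (use A finite_verts leaves_subset in \<open>auto simp: verts_G\<close>)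
  then have A5: "5 \<le> card A" using bowtie_distinct by simp
  have cA: "card A + card leaves = n"
    unfolding A using L finL card_mono[OF finite_verts L] n by (simp add: card_Diff_subset)
  have out: "card (arcs_between G leaves (verts G)) \<le> card leaves"
  proof -
    have "card (arcs_between G leaves (verts G)) \<le> (\<Sum>x\<in>leaves. degree G x)"
      by (rule card_arcs_between_le_degree_sum[OF simple_G L])
    also have "\<dots> = (\<Sum>x\<in>leaves. 1)"
      by (rule sum.cong[OF refl]) (use degree_not_r leaves_subset in auto)
    finally show ?thesis by simp
  qed
  have "adj G \<subseteq> arcs_between G A A \<union> (arcs_between G leaves (verts G) \<union> arcs_between G (verts G) leaves)"
    using adj_in_verts[OF simple_G] by (auto simp: arcs_between_def A)
  then have "card (adj G) \<le> card (arcs_between G A A \<union> (arcs_between G leaves (verts G) \<union> arcs_between G (verts G) leaves))"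
    by (rule card_mono[rotated]) (simp add: arcs_between_def finite_adj[OF simple_G])
  also have "\<dots> \<le> card (arcs_between G A A) + (card (arcs_between G leaves (verts G)) + card (arcs_between G (verts G) leaves))"
    by (meson add_le_mono card_Un_le le_trans order_refl)
  finally have "2 * card (edges G) \<le> card (arcs_between G A A) + 2 * card leaves"
    using out card_arcs_between_commute[of G leaves "verts G"] card_adj[OF simple_G] by simp
  then show ?thesis
    using G_bicyclic n cA A5 by (simp add: edge_bound_def c_cyclic_def)
qed

text \<open>Balance enters here. If no path has length 1, no neighbour of the root is a leaf. If one
  does, all paths have length at most 2, and every other non-leaf is a neighbour of the
  root.\<close>

lemma root_arcs:
  assumes bal: "\<And>p q. p \<in> set ps \<Longrightarrow> q \<in> set ps \<Longrightarrow> length p \<le> length q + 1"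
    and B: "B = verts G - leaves"
  shows "degree G r \<le> card (arcs_between G {r} B) \<or> card B - 1 \<le> card (arcs_between G {r} B)"
proof -
  have N: "card (arcs_between G {r} B) = card (nbhd G r \<inter> B)"
    using card_arcs_from[OF simple_G, of "{r}" B] r_in_verts by simp
  show ?thesis
  proof (cases "\<exists>p\<in>set ps. length p = 1")
    case False
    have "nbhd G r \<subseteq> B"
    proof
      fix x assume x: "x \<in> nbhd G r"
      then have xv: "x \<in> verts G" using nbhd_subset[OF simple_G, of r] by auto
      have "x \<notin> leaves"
      proof (cases "x \<in> {v2, v3, v4, v5}")
        case True then show ?thesis using leaves_subset by auto
      next
        case not_bt: False
        then obtain q where q: "q \<in> set ps" "x = q ! 0" using x nbhd_r by auto
        have "length q \<noteq> 0" "length q \<noteq> 1" using nonempty[OF q(1)] False q(1) by auto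
        then have "1 < length q" by linarith
        then have "0 < length q" "Suc 0 < length q" by auto
        then have "degree G x = 2" using degree_path_vertex[OF q(1), of 0] q(2) by simp
        moreover have "x \<noteq> r" using x nbhd_subset[OF simple_G, of r] by auto
        ultimately show ?thesis using degree_not_r[OF xv] by auto
      qed
      then show "x \<in> B" using xv B by simp
    qed
    then show ?thesis using N by (simp add: degree_def Int_absorb2)
  next
    case True
    then obtain p0 where p0: "p0 \<in> set ps" "length p0 = 1" by blast
    have "B - {r} \<subseteq> nbhd G r \<inter> B"
    proof
      fix x assume x: "x \<in> B - {r}"
      have "x \<in> nbhd G r"
      proof (cases "x \<in> set (concat ps)")
        case True
        then obtain p i where p: "p \<in> set ps" "i < length p" "x = p ! i" by (rule path_vertexE)
        have "length p \<le> 2" using bal[OF p(1) p0(1)] p0(2) by simp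
        moreover have "Suc i < length p"
          using degree_path_vertex[OF p(1,2)] degree_not_r[of x] x B p(3) by (auto split: if_splits)
        ultimately have "i = 0" by simp
        then show ?thesis using p nbhd_r by auto
      next
        case False
        then show ?thesis using x B nbhd_r by (auto simp: verts_G)
      qed
      then show "x \<in> nbhd G r \<inter> B" using x by simp
    qed
    then have "card (B - {r}) \<le> card (nbhd G r \<inter> B)"
      by (rule card_mono[rotated]) (simp add: finite_nbhd[OF simple_G])
    moreover have "r \<in> B" using r_in_verts leaves_subset B by auto
    ultimately show ?thesis using N finite_verts B by simp
  qed
qed

lemma paths_at_bowtie_precisely_extremal:
  assumes bal: "\<And>p q. p \<in> set ps \<Longrightarrow> q \<in> set ps \<Longrightarrow> length p \<le> length q + 1"
  shows "precisely_extremal \<pi> G"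
proof (rule precisely_extremal_criterion[OF _ G_bicyclic G_in_class])
  fix a b p q :: nat
  assume ab: "b \<le> a" and p: "p = card (level G a)" and q: "q = card (level G b)" and p1: "1 \<le> p"
  let ?N = "card (arcs_between G (level G a) (level G b))"
  have "level G a \<noteq> {}" using p p1 by auto
  then obtain u where u: "u \<in> level G a" by blast
  \<comment> \<open>If \<open>b \<le> 1\<close>, the lower level is everything and the degree sum is
    attained. If \<open>b \<ge> 3\<close>, both levels are \<open>{r}\<close> and the bound is 0.
    The mixed case is \<open>root_arcs\<close>, the remaining one \<open>inner_arcs\<close>.\<close>
  consider "b \<le> 1" | "3 \<le> b" | "b = 2" "3 \<le> a" | "b = 2" "a = 2" using ab by linarith
  then show "(\<Sum>u\<in>level G a. degree G u) \<le> ?N \<or>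
      edge_bound 2 p + (if p = 1 then q - 1 else edge_bound 2 q) \<le> ?N"
  proof cases
    case 1
    have "?N = (\<Sum>u\<in>level G a. card (nbhd G u \<inter> verts G))"
      unfolding levels(1)[OF 1] by (rule card_arcs_from[OF simple_G]) (auto simp: level_def)
    also have "\<dots> = (\<Sum>u\<in>level G a. degree G u)"
      unfolding degree_def
    proof (rule sum.cong[OF refl])
      fix u have "nbhd G u \<inter> verts G = nbhd G u" using nbhd_subset[OF simple_G, of u] by auto
      then show "card (nbhd G u \<inter> verts G) = card (nbhd G u)" by simp
    qed
    finally show ?thesis by simp
  next
    case 2
    have "level G a \<subseteq> {r}" "level G b \<subseteq> {r}" using levels(3) 2 ab by auto
    then have "p \<le> 1" "q \<le> 1" unfolding p q by (metis card_mono card.empty card.insert finite.emptyI finite.insertI empty_iff One_nat_def)+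
    then show ?thesis using p1 by (simp add: edge_bound_def)
  next
    case 3
    have A: "level G a = {r}" using u levels(3)[OF 3(2)] by auto
    then have "p = 1" using p by simp
    then show ?thesis
      using root_arcs[OF bal levels(2)] A 3 by (simp add: edge_bound_def q)
  next
    case 4
    have "edge_bound 2 p + edge_bound 2 q \<le> ?N"
      using inner_arcs[OF levels(2)] 4 p q by simp
    \<comment> \<open>Excludes \<open>p = 1\<close>, so the criterion asks for the full edge
      bound.\<close>
    moreover have "card {r, v2} \<le> p"
      unfolding p 4 levels(2)
      by (rule card_mono) (use finite_verts leaves_subset in \<open>auto simp: verts_G\<close>)
    ultimately show ?thesis using bowtie_distinct by auto
  qed
qed simp

end

end

lemma dg_less_length:
  assumes "H \<in> graph_class \<pi>" "1 \<le> i" "i \<le> length \<pi>"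
  shows "dg \<pi> i < length \<pi>"
proof -
  note sg = graph_class_simple[OF assms(1)]
  then have fin: "finite (verts H)" by (simp add: simple_graph_def)
  have "dg \<pi> i \<in># mset \<pi>" using assms(2,3) by (simp add: dg_def)
  then have "dg \<pi> i \<in># image_mset (degree H) (mset_set (verts H))"
    using assms(1) by (simp only: graph_class_def mem_Collect_eq)
  then obtain u where u: "u \<in> verts H" "degree H u = dg \<pi> i" using fin by auto
  have "card (nbhd H u) < card (verts H)"
    by (rule psubset_card_mono[OF fin]) (use nbhd_subset[OF sg, of u] u(1) in auto)
  then show ?thesis using u(2) graph_class_card_verts[OF assms(1)] by (simp add: degree_def)
qed

text \<open>The two alternatives of \<open>is_B_M\<close> are exhaustive: the second entry is at
  least 2, and if it equals 2, the degree sum forces \<open>5 \<le> dg \<pi> 1\<close>.\<close>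

lemma exists_B_M:
  fixes H :: "'a ugraph"
  assumes H: "H \<in> graph_class \<pi>" "c_cyclic 2 H" and \<pi>: "sorted_wrt (\<ge>) \<pi>" "last \<pi> = 1"
  shows "\<exists>G :: 'a ugraph. is_B_M \<pi> G"
proof -
  define n where "n = length \<pi>"
  have n4: "4 \<le> n"
    using c_cyclic_card_verts[OF H(2)] graph_class_length_ge_2[OF H(1) \<pi>(2)] graph_class_card_verts[OF H(1)]
    by (simp add: n_def)
  have "2 \<le> dg \<pi> 4" using dg_ge_2[OF H \<pi>] by simp
  then have d2: "2 \<le> dg \<pi> 2" using dg_antimono[OF \<pi>(1), of 2 4] n4 by (simp add: n_def)
  have d12: "dg \<pi> 2 \<le> dg \<pi> 1" using dg_antimono[OF \<pi>(1), of 1 2] n4 by (simp add: n_def)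
  show ?thesis
  proof (cases "3 \<le> dg \<pi> 2")
    case True
    obtain G :: "'a ugraph" and v where G: "greedy 2 G v (bfs_parent 2 (dg \<pi>))" "G \<in> graph_class \<pi>" "bfs_ordering G v"
      by (rule exists_greedy_in_class[OF H \<pi>]) (use True in auto)
    then have "is_B_M \<pi> G" unfolding is_B_M_def using greedy_reduced_graph[OF G(1)] True d12 by blast
    then show ?thesis by blast
  next
    case False
    then have d2: "dg \<pi> 2 = 2" using d2 by simp
    have split: "{1..n} = insert 1 {2..n}" "{2..n} = insert n {2..n - 1}" using n4 by auto
    have "(\<Sum>k=1..n. dg \<pi> k) = 2 * (n + 1)"
      using graph_class_sum_dg[OF H(1), of "\<lambda>x. x"] handshake[OF graph_class_simple[OF H(1)]] H(2)
        graph_class_card_verts[OF H(1)] by (simp add: c_cyclic_def n_def)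
    moreover have "(\<Sum>k=1..n. dg \<pi> k) = dg \<pi> 1 + (\<Sum>k=2..n. dg \<pi> k)" unfolding split(1) by simp
    moreover have "(\<Sum>k=2..n. dg \<pi> k) = dg \<pi> n + (\<Sum>k=2..n - 1. dg \<pi> k)"
      unfolding split(2) using n4 by simp
    moreover have "dg \<pi> n = 1" using dg_pos(2)[OF \<pi>, of 1] n4 by (simp add: n_def)
    moreover have "(\<Sum>k=2..n - 1. dg \<pi> k) \<le> (\<Sum>k=2..n - 1. 2)"
      by (rule sum_mono) (use dg_antimono[OF \<pi>(1), of 2] d2 in \<open>auto simp: n_def\<close>)
    moreover have "dg \<pi> 1 < n" using dg_less_length[OF H(1), of 1] n4 by (simp add: n_def)
    \<comment> \<open>From the sum \<open>2 * (n + 1)\<close> remove the final 1 and at most 2 for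
      each of the \<open>n - 2\<close> middle entries: 5 remain. The bound
      \<open>dg \<pi> 1 < n\<close> leaves a vertex for each path.\<close>
    ultimately have d1: "5 \<le> dg \<pi> 1" "dg \<pi> 1 - 4 \<le> n - 5" "5 \<le> n" using n4 by auto
    have fin: "finite (verts H)" using graph_class_simple[OF H(1)] by (simp add: simple_graph_def)
    obtain vs where vs: "set vs = verts H" "distinct vs" using finite_distinct_list[OF fin] by blast
    have len: "length vs = n" using vs graph_class_card_verts[OF H(1)] distinct_card by (fastforce simp: n_def)
    define xs where "xs = drop 5 vs"
    have "take 5 vs = [vs ! 0, vs ! 1, vs ! 2, vs ! 3, vs ! 4]"
      using len d1(3) by (intro nth_equalityI) (auto simp: less_Suc_eq numeral_eq_Suc)
    then have vs_eq: "vs = [vs ! 0, vs ! 1, vs ! 2, vs ! 3, vs ! 4] @ xs"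
      unfolding xs_def by (metis append_take_drop_id)
    have "1 \<le> dg \<pi> 1 - 4" "dg \<pi> 1 - 4 \<le> length xs" using d1 len by (auto simp: xs_def)
    then obtain ps where ps: "concat ps = xs" "length ps = dg \<pi> 1 - 4" "\<And>p. p \<in> set ps \<Longrightarrow> p \<noteq> []"
      "\<And>p q. p \<in> set ps \<Longrightarrow> q \<in> set ps \<Longrightarrow> length p \<le> length q + 1"
      by (rule list_balanced_partition) blast
    define G where "G = attach_paths (B2 (vs ! 0) (vs ! 1) (vs ! 2) (vs ! 3) (vs ! 4)) (vs ! 0) ps"
    have "verts G = set ([vs ! 0, vs ! 1, vs ! 2, vs ! 3, vs ! 4] @ xs)"
      by (simp add: G_def attach_paths_def B2_def ps(1) del: set_concat)
    then have "card (verts G) = length \<pi>"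
      unfolding vs_eq[symmetric] using vs(2) len by (simp add: distinct_card n_def)
    moreover have "distinct ([vs ! 0, vs ! 1, vs ! 2, vs ! 3, vs ! 4] @ concat ps)"
      unfolding ps(1) vs_eq[symmetric] by (rule vs(2))
    ultimately have "is_B_M \<pi> G" unfolding is_B_M_def G_def using d1 d2 ps(2-4) by blast
    then show ?thesis by blast
  qed
qed

text \<open>The second alternative of \<open>is_B_M\<close> does not assert membership in the class;
  \<open>H\<close> supplies the degree sum from which it is derived.\<close>

lemma B_M_precisely_extremal:
  fixes G H :: "'a ugraph"
  assumes H: "H \<in> graph_class \<pi>" "c_cyclic 2 H" and \<pi>: "sorted_wrt (\<ge>) \<pi>" "last \<pi> = 1"
    and G: "is_B_M \<pi> G"
  shows "precisely_extremal \<pi> G"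
proof -
  have n2: "2 \<le> length \<pi>" by (rule graph_class_length_ge_2[OF H(1) \<pi>(2)])
  from G consider v where "G \<in> graph_class \<pi>" "bfs_ordering G v" "is_reduced_graph G (B1 (v 1) (v 2) (v 3) (v 4))"
    | v1 v2 v3 v4 v5 ps where "5 \<le> dg \<pi> 1" "dg \<pi> 2 = 2" "card (verts G) = length \<pi>"
      "distinct ([v1, v2, v3, v4, v5] @ concat ps)" "length ps = dg \<pi> 1 - 4" "\<forall>p\<in>set ps. p \<noteq> []"
      "\<forall>p\<in>set ps. \<forall>q\<in>set ps. length p \<le> length q + 1" "G = attach_paths (B2 v1 v2 v3 v4 v5) v1 ps"
    unfolding is_B_M_def by blast
  then show ?thesis
  proof cases
    case 1
    show ?thesis
      by (rule B_M_precisely_extremal_of_B1[OF 1(1) graph_class_c_cyclic[OF H(1) 1(1) H(2)] n2 1(2,3)])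
  next
    case 2
    interpret P: paths_at_bowtie v1 v2 v3 v4 v5 ps by unfold_locales (use 2 in auto)
    have GP: "G = P.G" using 2(8) by (simp add: P.G_def)
    have pos: "1 \<le> x" if x: "x \<in> set \<pi>" for x
    proof -
      obtain i where "i < length \<pi>" "x = \<pi> ! i" using x by (auto simp: in_set_conv_nth)
      then show ?thesis using dg_pos(1)[OF \<pi>, of "Suc i"] by (simp add: dg_def)
    qed
    have total: "sum_list \<pi> = 2 * (length \<pi> + 1)"
      using graph_class_card_edges[OF H(1)] graph_class_card_verts[OF H(1)] H(2) by (simp add: c_cyclic_def)
    show ?thesis unfolding GP
      by (rule P.paths_at_bowtie_precisely_extremal[OF refl _ \<pi>(1) pos 2(1,2,5) total])
        (use 2 GP in auto)
  qed
qed

text \<open>As the extremal graphs are given by predicates, each existence claim ensures that the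
  universal claim beside it is not vacuous.\<close>

theorem theorem1p2:
  fixes \<pi> :: "nat list" and c :: nat
  assumes "c \<in> {0, 1, 2}"
    and "sorted_wrt (\<ge>) \<pi>"
    and "\<exists>G :: 'a ugraph. c_cyclic c G \<and> G \<in> graph_class \<pi>"
    and "last \<pi> = 1"
  shows "(c = 0 \<longrightarrow> (\<exists>G :: 'a ugraph. is_T_M \<pi> G) \<and>
              (\<forall>G :: 'a ugraph. is_T_M \<pi> G \<longrightarrow> precisely_extremal \<pi> G)) \<and>
         (c = 1 \<longrightarrow> (\<exists>G :: 'a ugraph. is_U_M \<pi> G) \<and>
              (\<forall>G :: 'a ugraph. is_U_M \<pi> G \<longrightarrow> precisely_extremal \<pi> G)) \<and>
         (c = 2 \<longrightarrow> (\<exists>G :: 'a ugraph. is_B_M \<pi> G) \<and>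
              (\<forall>G :: 'a ugraph. is_B_M \<pi> G \<longrightarrow> precisely_extremal \<pi> G))"
proof -
  obtain H :: "'a ugraph" where H: "H \<in> graph_class \<pi>" "c_cyclic c H" using assms(3) by blast
  have n2: "2 \<le> length \<pi>" by (rule graph_class_length_ge_2[OF H(1) assms(4)])
  have "\<exists>G :: 'a ugraph. is_T_M \<pi> G" if c: "c = 0"
  proof -
    obtain G :: "'a ugraph" and v where "G \<in> graph_class \<pi>" "c_cyclic 0 G" "bfs_ordering G v"
      by (rule exists_greedy_in_class[OF H assms(2,4)]) (use c in auto)
    then have "is_T_M \<pi> G" by (auto simp: is_T_M_def bfs_graph_def c_cyclic_def)
    then show ?thesis by blast
  qed
  then show ?thesis
    using T_M_precisely_extremal[OF _ n2] U_M_precisely_extremal[OF _ n2 assms(2)]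
      exists_U_M[OF H(1) _ assms(2,4)] exists_B_M[OF H(1) _ assms(2,4)]
      B_M_precisely_extremal[OF H(1) _ assms(2,4)] H(2)
    by blast
qed

end
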